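(* Let $W$ be a finite-dimensional real vector space and let $\mathcal{P}$ be a class of polyhedra in $W$ satisfying condition $(\dagger)$; let $\mathcal{C}=\{\operatorname{rec} P\mid P\in\mathcal{P}\}$. Let $\Sigma$ be a finite $\mathcal{C}$-fan. Suppose $\Phi\subset\Pi$ are $\mathcal{P}$-complexes ($\Phi$ a subcomplex of $\Pi$), both locally finite in $W(\Sigma)$, such that $\operatorname{rec} P\in\Sigma$ for all $P\in\Phi$ and $\Sigma':=\Sigma\cup\{\operatorname{rec} P\mid P\in\Pi\}$ is a fan. Then there is a $\mathcal{P}$-complex $\widetilde{\Pi}$ subdividing $\Pi$ which is locally finite in $W(\Sigma)$, with $\Phi\subset\widetilde{\Pi}$ and $\{\operatorname{rec} P\mid P\in\widetilde{\Pi}\}=\Sigma\cap\{\operatorname{rec} P\mid P\in\Pi\}$.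
   Context: Polyhedral complexes need not be finite; a fan is a nonempty polyhedral complex of pointed cones. A $\mathcal{P}$-complex is a polyhedral complex all of whose members lie in $\mathcal{P}$; a $\mathcal{C}$-fan is a fan all of whose cones lie in $\mathcal{C}$; a $\mathcal{P}$-polytopal subdivision is a subdivision consisting of polytopes in $\mathcal{P}$. A complex $\Pi'$ subdivides $\Pi$ if they have the same support and every member of $\Pi$ is a union of members of $\Pi'$. $\mathcal{P}$ satisfies $(\dagger)$ if: (I) $\mathcal{P}$ is closed under Minkowski sums; (II) for every nonzero $\sigma\in\mathcal{C}$ there is a ray $\rho\in\mathcal{C}$ meeting the relative interior of $\sigma$; (III) for every ray $\rho\in\mathcal{C}$ there is a $\mathcal{P}$-polytopal subdivision of $\rho$ that is locally finite in $\rho$. $W(\Sigma)$ is the tropical toric variety: as a set $\bigsqcup_{\sigma\in\Sigma}W/\operatorname{span}\sigma$, where $W(\sigma)=\bigsqcup_{\tau\le\sigma}W/\operatorname{span}\tau$ is identified with $\mathbb{R}_{\ge0}$-homogeneous monoid maps $\sigma^\vee\to\overline{\mathbb{R}}=\mathbb{R}\cup\{\infty\}$ ($w\in W/\operatorname{span}\tau$ gives $u\mapsto\langle u,w\rangle$ on $\tau^\perp$, $\infty$ elsewhere) with the topology of pointwise convergence ($\overline{\mathbb{R}}\cong\mathbb{R}_{\ge0}$ via $a\mapsto e^{-a}$), and these open pieces are glued; $W\subset W(\Sigma)$. Locally finite in $X$: each point of $X$ has a neighborhood meeting finitely many members. *)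

theory Defs
  imports "HOL-Analysis.Analysis"
begin

text \<open>
  A finite-dimensional real vector space is rendered as a linear subspace \<open>W\<close> of a Euclidean
  space (rather than as the whole type, whose dimension is never \<open>0\<close>). The dual of \<open>W\<close> is
  identified with \<open>W\<close> by the inner product. Polyhedra in \<open>W\<close> are the polyhedra of the ambient
  space that are contained in \<open>W\<close>.

  Members of complexes are nonempty, so the empty set, which the library counts both as a
  polyhedron and as a face, has to be excluded explicitly.
\<close>

definition rec_cone :: "'a::euclidean_space set \<Rightarrow> 'a set" where
  "rec_cone P = {v. \<forall>x\<in>P. \<forall>t\<ge>0. x + t *\<^sub>R v \<in> P}"

text \<open>Two members may be disjoint: \<open>{} face_of P\<close> holds for every \<open>P\<close>.\<close>

definition polyhedral_complex :: "'a::euclidean_space set set \<Rightarrow> bool" where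
  "polyhedral_complex K \<longleftrightarrow>
     (\<forall>P\<in>K. polyhedron P \<and> P \<noteq> {}) \<and>
     (\<forall>P\<in>K. \<forall>F. F face_of P \<and> F \<noteq> {} \<longrightarrow> F \<in> K) \<and>
     (\<forall>P\<in>K. \<forall>Q\<in>K. (P \<inter> Q) face_of P \<and> (P \<inter> Q) face_of Q)"

definition complex_in :: "'a::euclidean_space set set \<Rightarrow> 'a set set \<Rightarrow> bool" where
  "complex_in \<P> K \<longleftrightarrow> polyhedral_complex K \<and> K \<subseteq> \<P>"

definition pointed :: "'a::euclidean_space set \<Rightarrow> bool" where
  "pointed \<sigma> \<longleftrightarrow> \<sigma> \<inter> uminus ` \<sigma> = {0}"

definition fan :: "'a::euclidean_space set set \<Rightarrow> bool" where
  "fan \<Sigma> \<longleftrightarrow> polyhedral_complex \<Sigma> \<and> \<Sigma> \<noteq> {} \<and> (\<forall>\<sigma>\<in>\<Sigma>. cone \<sigma> \<and> pointed \<sigma>)"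

definition fan_in :: "'a::euclidean_space set set \<Rightarrow> 'a set set \<Rightarrow> bool" where
  "fan_in \<C> \<Sigma> \<longleftrightarrow> fan \<Sigma> \<and> \<Sigma> \<subseteq> \<C>"

definition subdivides :: "'a set set \<Rightarrow> 'a set set \<Rightarrow> bool" (infix \<open>subdivides\<close> 50) where
  "K' subdivides K \<longleftrightarrow> \<Union>K' = \<Union>K \<and> (\<forall>P\<in>K. \<exists>S\<subseteq>K'. P = \<Union>S)"

definition face_complex :: "'a::euclidean_space set \<Rightarrow> 'a set set" where
  "face_complex P = {F. F face_of P \<and> F \<noteq> {}}"

definition ray :: "'a::euclidean_space set \<Rightarrow> bool" where
  "ray \<rho> \<longleftrightarrow> (\<exists>v. v \<noteq> 0 \<and> \<rho> = {t *\<^sub>R v | t. 0 \<le> t})"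

definition polytopal_subdivision :: "'a::euclidean_space set set \<Rightarrow> 'a set \<Rightarrow> 'a set set \<Rightarrow> bool" where
  "polytopal_subdivision \<P> P K \<longleftrightarrow>
     complex_in \<P> K \<and> (\<forall>Q\<in>K. polytope Q) \<and> K subdivides face_complex P"

text \<open>The operator \<open>+\<close> on sets is the Minkowski sum.\<close>

definition dagger :: "'a::euclidean_space set set \<Rightarrow> bool" where
  "dagger \<P> \<longleftrightarrow>
     (\<forall>P\<in>\<P>. \<forall>Q\<in>\<P>. P + Q \<in> \<P>) \<and>
     (\<forall>\<sigma>\<in>rec_cone ` \<P>. \<sigma> \<noteq> {0} \<longrightarrow>
        (\<exists>\<rho>\<in>rec_cone ` \<P>. ray \<rho> \<and> \<rho> \<inter> rel_interior \<sigma> \<noteq> {})) \<and>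
     (\<forall>\<rho>\<in>rec_cone ` \<P>. ray \<rho> \<longrightarrow>
        (\<exists>K. polytopal_subdivision \<P> \<rho> K \<and> locally_finite_in (top_of_set \<rho>) K))"

text \<open>
  A point of the stratum \<open>W / span \<sigma>\<close> is a pair of \<open>\<sigma>\<close> and a coset of \<open>span \<sigma>\<close>; the first
  component makes the union of the strata disjoint.
\<close>

type_synonym 'a trop_pt = "'a set \<times> 'a set"

definition trop_point :: "'a::euclidean_space set \<Rightarrow> 'a \<Rightarrow> 'a trop_pt" where
  "trop_point \<sigma> w = (\<sigma>, (+) w ` span \<sigma>)"

definition trop_carrier :: "'a::euclidean_space set \<Rightarrow> 'a set set \<Rightarrow> 'a trop_pt set" where
  "trop_carrier W \<Sigma> = {trop_point \<sigma> w | \<sigma> w. \<sigma> \<in> \<Sigma> \<and> w \<in> W}"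

definition dual_cone :: "'a::euclidean_space set \<Rightarrow> 'a set \<Rightarrow> 'a set" where
  "dual_cone W \<sigma> = {u \<in> W. \<forall>x\<in>\<sigma>. 0 \<le> u \<bullet> x}"

text \<open>
  The value at \<open>u\<close> of the monoid map attached to a point. On the orthogonal complement of \<open>\<tau>\<close>
  it does not depend on the chosen representative of the coset (lemma \<open>trop_eval_point\<close>).
\<close>

definition trop_eval :: "'a::euclidean_space trop_pt \<Rightarrow> 'a \<Rightarrow> ereal" where
  "trop_eval p u =
     (case p of (\<tau>, A) \<Rightarrow> if \<forall>x\<in>\<tau>. u \<bullet> x = 0 then ereal (u \<bullet> (SOME w. w \<in> A)) else \<infinity>)"

text \<open>
  The affine piece \<open>W(\<sigma>)\<close>, with the topology of pointwise convergence of the monoid maps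
  from the dual cone to the subspace \<open>\<real> \<union> {\<infinity>}\<close> of the extended reals.
\<close>

abbreviation trop_piece :: "'a::euclidean_space set \<Rightarrow> 'a set \<Rightarrow> 'a trop_pt set" where
  "trop_piece W \<sigma> \<equiv> trop_carrier W (face_complex \<sigma>)"

definition trop_piece_topology :: "'a::euclidean_space set \<Rightarrow> 'a set \<Rightarrow> 'a trop_pt topology" where
  "trop_piece_topology W \<sigma> =
     pullback_topology (trop_piece W \<sigma>) (\<lambda>p. restrict (trop_eval p) (dual_cone W \<sigma>))
       (product_topology (\<lambda>u. top_of_set (- {- \<infinity>})) (dual_cone W \<sigma>))"

text \<open>Gluing: a set is open iff its intersection with every affine piece is open there.\<close>

definition trop_toric :: "'a::euclidean_space set \<Rightarrow> 'a set set \<Rightarrow> 'a trop_pt topology" where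
  "trop_toric W \<Sigma> =
     topology (\<lambda>U. U \<subseteq> trop_carrier W \<Sigma> \<and>
       (\<forall>\<sigma>\<in>\<Sigma>. openin (trop_piece_topology W \<sigma>) (U \<inter> trop_piece W \<sigma>)))"

text \<open>The inclusion of \<open>W\<close> as the stratum of the cone \<open>{0}\<close>.\<close>

definition trop_embed :: "'a::euclidean_space \<Rightarrow> 'a trop_pt" where
  "trop_embed w = trop_point {0} w"

definition locally_finite_in_trop ::
    "'a::euclidean_space set \<Rightarrow> 'a set set \<Rightarrow> 'a set set \<Rightarrow> bool" where
  "locally_finite_in_trop W \<Sigma> K \<longleftrightarrow> locally_finite_in (trop_toric W \<Sigma>) ((`) trop_embed ` K)"

lemma inj_trop_embed: "inj trop_embed"
  by (auto simp: inj_def trop_embed_def trop_point_def)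

lemma trop_eval_point:
  assumes "\<And>x. x \<in> \<tau> \<Longrightarrow> u \<bullet> x = 0"
  shows "trop_eval (trop_point \<tau> w) u = ereal (u \<bullet> w)"
proof -
  have orth: "u \<bullet> v = 0" if "v \<in> span \<tau>" for v
    by (rule span_induct[OF that]) (auto simp: assms subspace_def inner_add_right)
  have "w \<in> (+) w ` span \<tau>"
    using span_zero by force
  then have "(SOME y. y \<in> (+) w ` span \<tau>) \<in> (+) w ` span \<tau>"
    by (rule someI)
  then show ?thesis
    using assms orth by (auto simp: trop_eval_def trop_point_def inner_add_right)
qed

lemma trop_eval_point_infinity:
  assumes "x \<in> \<tau>" "u \<bullet> x \<noteq> 0"
  shows "trop_eval (trop_point \<tau> w) u = \<infinity>"
  using assms by (auto simp: trop_eval_def trop_point_def)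

lemma topspace_trop_piece_topology: "topspace (trop_piece_topology W \<sigma>) = trop_piece W \<sigma>"
  by (auto simp: trop_piece_topology_def topspace_pullback_topology trop_eval_def
      split: prod.splits)

lemma openin_trop_toric:
  "openin (trop_toric W \<Sigma>) U \<longleftrightarrow> U \<subseteq> trop_carrier W \<Sigma> \<and>
     (\<forall>\<sigma>\<in>\<Sigma>. openin (trop_piece_topology W \<sigma>) (U \<inter> trop_piece W \<sigma>))"
proof -
  have "istopology (\<lambda>U. U \<subseteq> trop_carrier W \<Sigma> \<and>
     (\<forall>\<sigma>\<in>\<Sigma>. openin (trop_piece_topology W \<sigma>) (U \<inter> trop_piece W \<sigma>)))"
    unfolding istopology_def
  proof (intro conjI allI impI ballI)
    fix S T \<sigma>
    assume "S \<subseteq> trop_carrier W \<Sigma> \<and>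
        (\<forall>\<sigma>\<in>\<Sigma>. openin (trop_piece_topology W \<sigma>) (S \<inter> trop_piece W \<sigma>))"
      and "T \<subseteq> trop_carrier W \<Sigma> \<and>
        (\<forall>\<sigma>\<in>\<Sigma>. openin (trop_piece_topology W \<sigma>) (T \<inter> trop_piece W \<sigma>))"
      and "\<sigma> \<in> \<Sigma>"
    then have "openin (trop_piece_topology W \<sigma>)
        ((S \<inter> trop_piece W \<sigma>) \<inter> (T \<inter> trop_piece W \<sigma>))"
      by (blast intro: openin_Int)
    moreover have "(S \<inter> trop_piece W \<sigma>) \<inter> (T \<inter> trop_piece W \<sigma>) = S \<inter> T \<inter> trop_piece W \<sigma>"
      by blast
    ultimately show "openin (trop_piece_topology W \<sigma>) (S \<inter> T \<inter> trop_piece W \<sigma>)"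
      by simp
  next
    fix \<U> \<sigma>
    assume *: "\<forall>U\<in>\<U>. U \<subseteq> trop_carrier W \<Sigma> \<and>
        (\<forall>\<sigma>\<in>\<Sigma>. openin (trop_piece_topology W \<sigma>) (U \<inter> trop_piece W \<sigma>))"
      and "\<sigma> \<in> \<Sigma>"
    then have "openin (trop_piece_topology W \<sigma>) (\<Union>U\<in>\<U>. U \<inter> trop_piece W \<sigma>)"
      by (intro openin_Union) auto
    then show "openin (trop_piece_topology W \<sigma>) (\<Union>\<U> \<inter> trop_piece W \<sigma>)"
      by (simp only: Int_Union2)
  qed auto
  then show ?thesis
    by (simp add: trop_toric_def)
qed

lemma topspace_trop_toric:
  assumes "fan \<Sigma>"
  shows "topspace (trop_toric W \<Sigma>) = trop_carrier W \<Sigma>"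
proof
  show "topspace (trop_toric W \<Sigma>) \<subseteq> trop_carrier W \<Sigma>"
    using openin_topspace openin_trop_toric by blast
  have "trop_carrier W \<Sigma> \<inter> trop_piece W \<sigma> = trop_piece W \<sigma>" if "\<sigma> \<in> \<Sigma>" for \<sigma>
  proof -
    have "face_complex \<sigma> \<subseteq> \<Sigma>"
      using assms that unfolding fan_def polyhedral_complex_def face_complex_def by blast
    then have "trop_piece W \<sigma> \<subseteq> trop_carrier W \<Sigma>"
      unfolding trop_carrier_def by blast
    then show ?thesis
      by (rule Int_absorb1)
  qed
  moreover have "openin (trop_piece_topology W \<sigma>) (trop_piece W \<sigma>)" for \<sigma>
    using openin_topspace[of "trop_piece_topology W \<sigma>"]
    by (simp only: topspace_trop_piece_topology)
  ultimately have "openin (trop_toric W \<Sigma>) (trop_carrier W \<Sigma>)"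
    unfolding openin_trop_toric by (simp only: subset_refl simp_thms ball_simps) simp
  then show "trop_carrier W \<Sigma> \<subseteq> topspace (trop_toric W \<Sigma>)"
    by (rule openin_subset)
qed

end

theory Submission
  imports Defs
begin

text \<open>
  The members of \<open>\<Pi>\<^sub>0\<close> whose recession cone lies outside \<open>\<Sigma>\<close> are cut up, in order of decreasing dimension
  of the recession cone. Let \<open>\<sigma> = rec P \<notin> \<Sigma>\<close> have the largest dimension and let \<open>v\<close> be a point of the
  relative interior of \<open>\<sigma>\<close> on a ray that has a \<open>\<P>\<close>-polytopal subdivision \<open>K\<close>. Every point of \<open>P\<close> is
  uniquely \<open>y + t v\<close> with \<open>t \<ge> 0\<close> and \<open>y\<close> in the part of the boundary at which the direction \<open>-v\<close> leaves
  \<open>P\<close>; this part is a union of faces \<open>F\<close>, so \<open>P\<close> is subdivided by the prisms \<open>F + B\<close> with \<open>B \<in> K\<close>, and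
  \<open>rec (F + B) = rec F\<close> is a proper face of \<open>\<sigma>\<close>. By maximality of the dimension, \<open>P \<inter> Q\<close> has recession
  cone \<open>\<sigma>\<close> only if \<open>Q\<close> does, so these subdivisions fit together.

  Local finiteness at a point of the stratum of \<open>\<tau> \<in> \<Sigma>\<close>: since \<open>v \<notin> \<tau>\<close>, some linear form \<open>u\<close> is nonnegative
  on \<open>\<tau>\<close>, nonpositive on \<open>\<sigma>\<close> and negative at \<open>v\<close>. It is bounded above on \<open>P\<close>, whereas \<open>u > c\<close> defines a
  neighbourhood of the point for a suitable \<open>c\<close>, so the height \<open>t\<close> is bounded on \<open>P\<close> near the point.
\<close>

section \<open>Recession cones\<close>

lemma rec_coneD: "v \<in> rec_cone P \<Longrightarrow> x \<in> P \<Longrightarrow> 0 \<le> t \<Longrightarrow> x + t *\<^sub>R v \<in> P"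
  by (simp add: rec_cone_def)

lemma cone_rec_cone: "cone (rec_cone P)"
  unfolding cone_def rec_cone_def by (auto simp: mult_nonneg_nonneg)

lemma rec_cone_add:
  assumes "v \<in> rec_cone P" "w \<in> rec_cone P"
  shows "v + w \<in> rec_cone P"
  unfolding rec_cone_def
proof (clarsimp)
  fix x and t :: real assume "x \<in> P" "0 \<le> t"
  then have "x + t *\<^sub>R v + t *\<^sub>R w \<in> P"
    using assms by (intro rec_coneD)
  then show "x + t *\<^sub>R (v + w) \<in> P"
    by (simp add: algebra_simps)
qed

text \<open>The point \<open>y + t *\<^sub>R v\<close> is a limit of convex combinations of
  \<open>y\<close> and \<open>x n\<close>; the weight \<open>t * c n\<close> of \<open>x n\<close>
  is eventually below 1.\<close>

lemma rec_cone_limit: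
  fixes P :: "'a::euclidean_space set"
  assumes P: "closed P" "convex P"
    and x: "\<And>n. x n \<in> P" and c: "\<And>n. 0 < c n" "c \<longlonglongrightarrow> 0"
    and lim: "(\<lambda>n. c n *\<^sub>R x n) \<longlonglongrightarrow> v"
  shows "v \<in> rec_cone P"
  unfolding rec_cone_def
proof clarsimp
  fix y and t :: real assume y: "y \<in> P" and t: "0 \<le> t"
  have "(\<lambda>n. (1 - t * c n) *\<^sub>R y + t *\<^sub>R (c n *\<^sub>R x n)) \<longlonglongrightarrow> (1 - t * 0) *\<^sub>R y + t *\<^sub>R v"
    by (intro tendsto_intros c lim)
  moreover have "\<forall>\<^sub>F n in sequentially. (1 - t * c n) *\<^sub>R y + t *\<^sub>R (c n *\<^sub>R x n) \<in> P"
  proof -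
    have "(\<lambda>n. t * c n) \<longlonglongrightarrow> t * 0"
      by (intro tendsto_intros c)
    then have "\<forall>\<^sub>F n in sequentially. t * c n < 1"
      by (rule order_tendstoD) simp
    then show ?thesis
    proof eventually_elim
      case (elim n)
      have "(1 - t * c n) *\<^sub>R y + (t * c n) *\<^sub>R x n \<in> P"
        using P y x t c elim by (intro convexD) (auto simp: less_imp_le)
      then show ?case by simp
    qed
  qed
  ultimately show "y + t *\<^sub>R v \<in> P"
    using Lim_in_closed_set[OF P(1) _ sequentially_bot] by fastforce
qed

text \<open>Dividing the points \<open>x + real n *\<^sub>R v\<close> by \<open>n + 1\<close> gives
  a sequence with limit \<open>v\<close>, so a ray from one base point already yields a ray from
  every other.\<close>

lemma rec_coneI_ray:
  fixes P :: "'a::euclidean_space set"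
  assumes "closed P" "convex P" and ray: "\<And>t. 0 \<le> t \<Longrightarrow> x + t *\<^sub>R v \<in> P"
  shows "v \<in> rec_cone P"
proof (rule rec_cone_limit[OF assms(1,2)])
  show "x + real n *\<^sub>R v \<in> P" for n
    by (rule ray) simp
  show "0 < inverse (real (Suc n))" for n by simp
  show "(\<lambda>n. inverse (real (Suc n))) \<longlonglongrightarrow> 0"
    by (rule LIMSEQ_inverse_real_of_nat)
  have "(\<lambda>n. inverse (real (Suc n)) *\<^sub>R (x - v) + v) \<longlonglongrightarrow> 0 *\<^sub>R (x - v) + v"
    by (intro tendsto_intros LIMSEQ_inverse_real_of_nat)
  moreover have "inverse (real (Suc n)) *\<^sub>R (x - v) + v = inverse (real (Suc n)) *\<^sub>R (x + real n *\<^sub>R v)" for n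
  proof -
    have "v = inverse (real (Suc n)) *\<^sub>R (real (Suc n) *\<^sub>R v)" by simp
    then have "inverse (real (Suc n)) *\<^sub>R (x - v) + v
        = inverse (real (Suc n)) *\<^sub>R ((x - v) + real (Suc n) *\<^sub>R v)"
      by (metis scaleR_right_distrib)
    also have "(x - v) + real (Suc n) *\<^sub>R v = x + real n *\<^sub>R v"
      by (simp add: algebra_simps)
    finally show ?thesis .
  qed
  ultimately show "(\<lambda>n. inverse (real (Suc n)) *\<^sub>R (x + real n *\<^sub>R v)) \<longlonglongrightarrow> v"
    by simp
qed

text \<open>Points of norm tending to infinity, normalised to length 1, have a convergent
  subsequence on the unit sphere; its limit is a recession direction.\<close>

lemma unbounded_imp_rec_cone:
  fixes P :: "'a::euclidean_space set"
  assumes P: "closed P" "convex P" and "\<not> bounded P"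
  shows "\<exists>v\<in>rec_cone P. v \<noteq> 0"
proof -
  have "\<exists>x\<in>P. real (Suc n) < norm x" for n
    using \<open>\<not> bounded P\<close> unfolding bounded_iff by (meson not_le)
  then obtain x where x: "\<And>n. x n \<in> P" "\<And>n. real (Suc n) < norm (x n)"
    by metis
  have pos: "0 < norm (x n)" for n
    using x(2)[of n] by linarith
  define c where "c = (\<lambda>n. inverse (norm (x n)))"
  have c0: "c \<longlonglongrightarrow> 0"
  proof (rule tendsto_sandwich)
    show "\<forall>\<^sub>F n in sequentially. 0 \<le> c n" by (simp add: c_def)
    show "\<forall>\<^sub>F n in sequentially. c n \<le> inverse (real (Suc n))"
      unfolding c_def using x(2) by (intro always_eventually allI le_imp_inverse_le) (auto simp: less_imp_le)
  qed (simp, rule LIMSEQ_inverse_real_of_nat)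
  have "\<forall>n. c n *\<^sub>R x n \<in> sphere 0 1"
    using pos by (simp add: c_def)
  then obtain v r where v: "v \<in> sphere 0 1" and r: "strict_mono r"
    and lim: "((\<lambda>n. c n *\<^sub>R x n) \<circ> r) \<longlonglongrightarrow> v"
    using seq_compactE[OF compact_imp_seq_compact[OF compact_sphere], of "\<lambda>n. c n *\<^sub>R x n" 0 1] by blast
  have "v \<in> rec_cone P"
  proof (rule rec_cone_limit[OF P])
    show "x (r n) \<in> P" for n by (rule x)
    show "0 < c (r n)" for n using pos by (simp add: c_def)
    show "(\<lambda>n. c (r n)) \<longlonglongrightarrow> 0"
      using LIMSEQ_subseq_LIMSEQ[OF c0 r] by (simp add: o_def)
    show "(\<lambda>n. c (r n) *\<^sub>R x (r n)) \<longlonglongrightarrow> v"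
      using lim by (simp add: o_def)
  qed
  moreover have "v \<noteq> 0" using v by auto
  ultimately show ?thesis by blast
qed

text \<open>For the inclusion into \<open>rec_cone F\<close>, go far along \<open>v\<close> from a
  point of \<open>F + B\<close>, split into summands and divide by the parameter. The summands in
  \<open>B\<close> are bounded and vanish in the limit, so \<open>v\<close> is a limit of scaled
  points of \<open>F\<close>.\<close>

lemma rec_cone_plus_compact:
  fixes F B :: "'a::euclidean_space set"
  assumes F: "closed F" "convex F" "F \<noteq> {}" and B: "compact B" "B \<noteq> {}"
  shows "rec_cone (F + B) = rec_cone F"
proof
  show "rec_cone F \<subseteq> rec_cone (F + B)"
  proof
    fix v assume v: "v \<in> rec_cone F"
    show "v \<in> rec_cone (F + B)"
      unfolding rec_cone_def
    proof (clarsimp elim!: set_plus_elim)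
      fix t :: real and f b assume "0 \<le> t" "f \<in> F" "b \<in> B"
      then have "(f + t *\<^sub>R v) + b \<in> F + B"
        using v by (intro set_plus_intro rec_coneD)
      then show "f + b + t *\<^sub>R v \<in> F + B"
        by (simp add: algebra_simps)
    qed
  qed
  show "rec_cone (F + B) \<subseteq> rec_cone F"
  proof
    fix v assume v: "v \<in> rec_cone (F + B)"
    obtain f b where fb: "f \<in> F" "b \<in> B" using F B by auto
    have "\<exists>g\<in>F. \<exists>e\<in>B. f + b + real (Suc n) *\<^sub>R v = g + e" for n
      using rec_coneD[OF v set_plus_intro[OF fb], of "real (Suc n)"]
      by (auto elim!: set_plus_elim)
    then obtain g e where g: "\<And>n. g n \<in> F" "\<And>n. e n \<in> B"
      "\<And>n. f + b + real (Suc n) *\<^sub>R v = g n + e n"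
      by metis
    define c where "c = (\<lambda>n. inverse (real (Suc n)))"
    have c0: "c \<longlonglongrightarrow> 0" unfolding c_def by (rule LIMSEQ_inverse_real_of_nat)
    have "c n *\<^sub>R g n = v + c n *\<^sub>R (f + b) - c n *\<^sub>R e n" for n
    proof -
      have "g n = real (Suc n) *\<^sub>R v + (f + b) - e n"
        using g(3)[of n] by (simp add: algebra_simps)
      then have "c n *\<^sub>R g n = (c n * real (Suc n)) *\<^sub>R v + c n *\<^sub>R (f + b) - c n *\<^sub>R e n"
        by (simp only: scaleR_right_distrib scaleR_right_diff_distrib scaleR_scaleR)
      also have "c n * real (Suc n) = 1" by (simp add: c_def)
      finally show ?thesis by simp
    qed
    moreover have "(\<lambda>n. c n *\<^sub>R e n) \<longlonglongrightarrow> 0"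
    proof -
      obtain M where "\<And>x. x \<in> B \<Longrightarrow> norm x \<le> M"
        using compact_imp_bounded[OF B(1)] unfolding bounded_iff by blast
      then have "norm (c n *\<^sub>R e n) \<le> c n * M" for n
        using g(2)[of n] by (simp add: c_def divide_simps)
      moreover have "(\<lambda>n. c n * M) \<longlonglongrightarrow> 0 * M"
        by (intro tendsto_intros c0)
      ultimately show ?thesis
        by (metis (no_types, lifting) Lim_null_comparison always_eventually mult_zero_left)
    qed
    ultimately have "(\<lambda>n. c n *\<^sub>R g n) \<longlonglongrightarrow> v + 0 *\<^sub>R (f + b) - 0"
      by (simp only:) (intro tendsto_intros c0)
    then show "v \<in> rec_cone F"
      using c0 by (intro rec_cone_limit[OF F(1,2) g(1), of c]) (auto simp: c_def)
  qed
qed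

lemma rec_cone_subset_of_closed:
  fixes R P :: "'a::euclidean_space set"
  assumes "closed P" "convex P" "R \<subseteq> P" "R \<noteq> {}"
  shows "rec_cone R \<subseteq> rec_cone P"
proof
  fix v assume v: "v \<in> rec_cone R"
  obtain x where "x \<in> R" using assms by blast
  then show "v \<in> rec_cone P"
    using assms(1,2,3) rec_coneD[OF v] by (intro rec_coneI_ray[of _ x]) auto
qed

lemma convex_rec_cone: "convex (rec_cone P)"
proof (rule convexI)
  fix x y and u v :: real
  assume "x \<in> rec_cone P" "y \<in> rec_cone P" "0 \<le> u" "0 \<le> v"
  then show "u *\<^sub>R x + v *\<^sub>R y \<in> rec_cone P"
    by (intro rec_cone_add mem_cone cone_rec_cone)
qed

lemma in_open_segment_add_scaleR:
  fixes a v :: "'a::real_vector"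
  assumes "v \<noteq> 0" "r < s" "s < t"
  shows "a + s *\<^sub>R v \<in> open_segment (a + r *\<^sub>R v) (a + t *\<^sub>R v)"
proof -
  define u where "u = (s - r) / (t - r)"
  have "u * (t - r) = s - r"
    using assms by (simp add: u_def)
  then have "s = (1 - u) * r + u * t"
    by (simp add: algebra_simps)
  moreover have "0 < u" "u < 1"
    using assms by (auto simp: u_def)
  ultimately have u: "0 < u" "u < 1" "s = (1 - u) * r + u * t"
    by blast+
  have "(1 - u) *\<^sub>R (a + r *\<^sub>R v) + u *\<^sub>R (a + t *\<^sub>R v) = a + ((1 - u) * r + u * t) *\<^sub>R v"
    by (simp add: algebra_simps)
  then have "a + s *\<^sub>R v = (1 - u) *\<^sub>R (a + r *\<^sub>R v) + u *\<^sub>R (a + t *\<^sub>R v)"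
    by (simp only: u(3)[symmetric])
  then show ?thesis
    using u assms unfolding in_segment by auto
qed

text \<open>The given point of \<open>R\<close> lies strictly inside segments of \<open>P\<close>
  that start at \<open>x\<close> and reach arbitrarily far along \<open>v\<close>, so both ends of
  such segments are in \<open>R\<close>.\<close>

lemma face_of_rec_direction:
  assumes "R face_of P" "x + s *\<^sub>R v \<in> R" "0 < s" "x \<in> P" "v \<in> rec_cone P" "v \<noteq> 0" "0 \<le> t"
  shows "x + t *\<^sub>R v \<in> R"
proof -
  have inP: "x + q *\<^sub>R v \<in> P" if "0 \<le> q" for q
    using assms that by (intro rec_coneD)
  have "x + 0 *\<^sub>R v \<in> R \<and> x + q *\<^sub>R v \<in> R" if "s < q" for q
    using that assms(3,6)
    by (intro face_ofD[OF assms(1) in_open_segment_add_scaleR[of v 0 s q x]] inP assms(2)) auto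
  \<comment> \<open>The far end must lie beyond \<open>s\<close> for the face argument, and beyond
    \<open>t\<close> so that the point sought is between the ends.\<close>
  from this[of "s + t + 1"] have ends: "x + 0 *\<^sub>R v \<in> R" "x + (s + t + 1) *\<^sub>R v \<in> R"
    using assms(7) by auto
  show ?thesis
  proof (cases "t = 0")
    case True
    with ends show ?thesis by simp
  next
    case False
    have "convex R" using assms(1) by (simp add: face_of_imp_convex)
    then have "closed_segment (x + 0 *\<^sub>R v) (x + (s + t + 1) *\<^sub>R v) \<subseteq> R"
      using ends by (simp only: closed_segment_subset)
    moreover have "x + t *\<^sub>R v \<in> open_segment (x + 0 *\<^sub>R v) (x + (s + t + 1) *\<^sub>R v)"
      using assms(3,6,7) False by (intro in_open_segment_add_scaleR) auto
    ultimately show ?thesis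
      using open_closed_segment by blast
  qed
qed

text \<open>For \<open>x\<close> in \<open>R\<close>, the point \<open>x + t *\<^sub>R c\<close>
  lies strictly between \<open>x + t *\<^sub>R a\<close> and \<open>x + t *\<^sub>R b\<close>, which
  are in \<open>P\<close>; the face property of \<open>R\<close> applies to these segments.\<close>

lemma rec_cone_face_of:
  fixes R P :: "'a::euclidean_space set"
  assumes P: "closed P" "convex P" and "R face_of P" "R \<noteq> {}"
  shows "rec_cone R face_of rec_cone P"
  unfolding face_of_def
proof (intro conjI ballI impI)
  show "rec_cone R \<subseteq> rec_cone P"
    using assms rec_cone_subset_of_closed face_of_imp_subset by blast
  show "convex (rec_cone R)" by (rule convex_rec_cone)
next
  fix a b c
  assume a: "a \<in> rec_cone P" and b: "b \<in> rec_cone P" and c: "c \<in> rec_cone R"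
    and seg: "c \<in> open_segment a b"
  have key: "x + t *\<^sub>R a \<in> R \<and> x + t *\<^sub>R b \<in> R" if x: "x \<in> R" and t: "0 \<le> t" for x t
  proof (cases "t = 0")
    case False
    have xP: "x \<in> P" using x assms face_of_imp_subset by blast
    obtain u where u: "a \<noteq> b" "0 < u" "u < 1" "c = (1 - u) *\<^sub>R a + u *\<^sub>R b"
      using seg by (auto simp: in_segment)
    have "x + t *\<^sub>R c = (1 - u) *\<^sub>R (x + t *\<^sub>R a) + u *\<^sub>R (x + t *\<^sub>R b)"
      unfolding u(4) by (simp add: algebra_simps)
    then have "x + t *\<^sub>R c \<in> open_segment (x + t *\<^sub>R a) (x + t *\<^sub>R b)"
      using u False unfolding in_segment by auto
    then show ?thesis
      using face_ofD[OF assms(3)] rec_coneD[OF a xP t] rec_coneD[OF b xP t] rec_coneD[OF c x t]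
      by blast
  qed (use x in simp)
  show "a \<in> rec_cone R" "b \<in> rec_cone R"
    using key by (auto simp: rec_cone_def)
qed

section \<open>Separation of cones\<close>

text \<open>The intersection with a box around the origin is a polytope. A finite set having it as
  convex hull generates the cone, because every point of the cone can be scaled into the
  box.\<close>

lemma polyhedral_cone_finitely_generated:
  fixes \<sigma> :: "'a::euclidean_space set"
  assumes "polyhedron \<sigma>" "cone \<sigma>" "\<sigma> \<noteq> {}"
  obtains V where "finite V" "\<sigma> = convex_cone hull V"
proof -
  have cc: "convex_cone \<sigma>"
    using assms by (simp add: convex_cone_def polyhedron_imp_convex conic_def cone_def)
  have "polytope (\<sigma> \<inter> cbox (- One) One)"
    using assms by (intro polyhedron_Int_polytope polytope_interval)
  then obtain V where V: "finite V" "\<sigma> \<inter> cbox (- One) One = convex hull V"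
    unfolding polytope_def by blast
  have "\<sigma> = convex_cone hull V"
  proof
    have "V \<subseteq> \<sigma>" using V hull_subset[of V convex] by blast
    then show "convex_cone hull V \<subseteq> \<sigma>"
      using cc by (simp add: hull_minimal)
    show "\<sigma> \<subseteq> convex_cone hull V"
    proof
      fix x assume x: "x \<in> \<sigma>"
      define c where "c = 1 + norm x"
      have c: "0 < c" unfolding c_def by (smt (verit) norm_ge_zero)
      have "inverse c *\<^sub>R x \<in> \<sigma>"
        using x c assms by (intro mem_cone) auto
      moreover have "inverse c *\<^sub>R x \<in> cbox (- One) One"
      proof -
        have "\<bar>x \<bullet> i\<bar> \<le> c" if "i \<in> Basis" for i
          unfolding c_def using Basis_le_norm[OF that, of x] by simp
        then show ?thesis
          using c unfolding mem_box
          by (auto simp: field_simps abs_le_iff) (metis minus_le_iff)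
      qed
      ultimately have "inverse c *\<^sub>R x \<in> convex_cone hull V"
        using V convex_hull_subset_convex_cone_hull by blast
      then have "c *\<^sub>R (inverse c *\<^sub>R x) \<in> convex_cone hull V"
        using c convex_cone_hull_mul[of "inverse c *\<^sub>R x" V c] by linarith
      then show "x \<in> convex_cone hull V" using c by simp
    qed
  qed
  with V that show ?thesis by blast
qed

text \<open>The orthogonal projection of \<open>u\<close> to \<open>W\<close>. It makes a linear
  form on the whole space eligible for \<open>dual_cone W\<close>, whose elements lie in
  \<open>W\<close>.\<close>

lemma representative_in_subspace:
  fixes W :: "'a::euclidean_space set"
  assumes "subspace W"
  obtains u' where "u' \<in> W" "\<And>x. x \<in> W \<Longrightarrow> u' \<bullet> x = u \<bullet> x"
proof -
  obtain y z where "y \<in> span W" "\<And>w. w \<in> span W \<Longrightarrow> orthogonal z w" "u = y + z"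
    using orthogonal_subspace_decomp_exists[of W u] by metis
  then show ?thesis
    using that[of y] assms by (auto simp: orthogonal_def inner_add_left span_eq_iff[THEN iffD2])
qed

text \<open>The difference cone \<open>K\<close> of \<sigma> and \<tau> is closed, being finitely
  generated, and a hyperplane separating \<open>- v\<close> from it gives the form up to
  sign.\<close>

lemma separate_cones:
  fixes \<sigma> \<tau> :: "'a::euclidean_space set"
  assumes \<sigma>: "polyhedron \<sigma>" "cone \<sigma>" and \<tau>: "polyhedron \<tau>" "cone \<tau>"
    and face: "\<sigma> \<inter> \<tau> face_of \<sigma>" and v: "v \<in> \<sigma>" "v \<notin> \<tau>" and "0 \<in> \<tau>"
  obtains u where "\<And>x. x \<in> \<sigma> \<Longrightarrow> u \<bullet> x \<le> 0" "\<And>x. x \<in> \<tau> \<Longrightarrow> 0 \<le> u \<bullet> x" "u \<bullet> v < 0"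
proof -
  obtain A where A: "finite A" "\<sigma> = convex_cone hull A"
    using polyhedral_cone_finitely_generated[OF \<sigma>] v by auto
  obtain B where B: "finite B" "\<tau> = convex_cone hull B"
    using polyhedral_cone_finitely_generated[OF \<tau>] \<open>0 \<in> \<tau>\<close> by auto
  define K where "K = convex_cone hull (A \<union> uminus ` B)"
  have neg: "convex_cone hull (uminus ` B) = uminus ` (convex_cone hull B)"
    by (intro convex_cone_hull_linear_image linear_uminus)
  have K_eq: "K = {x - y |x y. x \<in> \<sigma> \<and> y \<in> \<tau>}"
    unfolding K_def A(2) B(2) convex_cone_hull_Un neg by auto
  have K: "closed K" "convex_cone K"
    unfolding K_def using A B by (auto intro: closed_convex_cone_hull convex_cone_convex_cone_hull)
  have zero: "0 \<in> \<sigma>" using A convex_cone_hull_contains_0 by blast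
  \<comment> \<open>Otherwise some \<open>t\<close> in both cones equals \<open>v + s\<close> with
    \<open>s\<close> in \<sigma>. Half of \<open>t\<close> is the midpoint of \<open>v\<close> and
    \<open>s\<close>, so the face property puts \<open>v\<close> into \<tau>; if
    \<open>s = v\<close>, this midpoint is \<open>v\<close> itself.\<close>
  have "- v \<notin> K"
  proof
    assume "- v \<in> K"
    then obtain s t where st: "s \<in> \<sigma>" "t \<in> \<tau>" "- v = s - t"
      unfolding K_eq by auto
    have t: "t = v + s" using st(3) by (simp add: algebra_simps)
    have "v + s \<in> \<sigma>"
      using A(2) st(1) v(1) convex_cone_hull_add by blast
    with st t have tI: "t \<in> \<sigma> \<inter> \<tau>" by simp
    show False
    proof (cases "s = v")
      case True
      have "(1/2) *\<^sub>R t \<in> \<tau>" using \<tau> st by (intro mem_cone) auto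
      with t True v show False by (simp add: scaleR_2[symmetric])
    next
      case False
      have h: "(1/2) *\<^sub>R t \<in> \<sigma> \<inter> \<tau>" using \<tau> \<sigma> tI by (auto intro: mem_cone)
      have "(1/2) *\<^sub>R t \<in> open_segment v s"
        unfolding in_segment t using False by (intro conjI exI[of _ "1/2"]) (auto simp: algebra_simps)
      then show False
        using face_ofD[OF face _ v(1) st(1) h] v by blast
    qed
  qed
  then obtain u b where u: "u \<bullet> (- v) < b" "\<forall>x\<in>K. b < u \<bullet> x"
    using separating_hyperplane_closed_point[of K "- v"] K by (auto simp: convex_cone_def)
  have "0 \<in> K" using K convex_cone_contains_0 by blast
  then have b: "b < 0" using u by fastforce
  \<comment> \<open>A linear form bounded below on a cone is nonnegative there: a negative value
    could be scaled to exactly \<open>b\<close>.\<close>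
  have ge: "0 \<le> u \<bullet> x" if "x \<in> K" for x
  proof (rule ccontr)
    assume "\<not> 0 \<le> u \<bullet> x"
    then have neg: "u \<bullet> x < 0" by simp
    have "(b / (u \<bullet> x)) *\<^sub>R x \<in> K"
      using K that neg b by (intro convex_cone_scaleR) (auto simp: divide_simps)
    with u have "b < u \<bullet> ((b / (u \<bullet> x)) *\<^sub>R x)" by blast
    with neg show False by simp
  qed
  show ?thesis
  proof (rule that[of "- u"])
    fix x assume "x \<in> \<sigma>"
    then have "x - 0 \<in> K" unfolding K_eq using \<open>0 \<in> \<tau>\<close> by blast
    then show "- u \<bullet> x \<le> 0" using ge by fastforce
  next
    fix x assume "x \<in> \<tau>"
    then have "0 - x \<in> K" unfolding K_eq using zero by blast
    then show "0 \<le> - u \<bullet> x" using ge by fastforce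
  next
    show "- u \<bullet> v < 0" using u b by simp
  qed
qed

section \<open>Neighbourhoods in the tropical toric variety\<close>

lemma openin_trop_piece_eval:
  assumes "u \<in> dual_cone W \<sigma>" "open S"
  shows "openin (trop_piece_topology W \<sigma>) {p \<in> trop_piece W \<sigma>. trop_eval p u \<in> S}"
proof -
  let ?T = "product_topology (\<lambda>u. top_of_set (- {- \<infinity>})) (dual_cone W \<sigma>) :: ('a \<Rightarrow> ereal) topology"
  have "continuous_map ?T (top_of_set (- {- \<infinity>})) (\<lambda>g. g u)"
    using assms by (intro continuous_map_product_projection)
  then have "openin ?T {g \<in> topspace ?T. g u \<in> (- {- \<infinity>}) \<inter> S}"
    using assms(2) by (intro openin_continuous_map_preimage[of _ "top_of_set (- {- \<infinity>})"]) auto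
  moreover have "{p \<in> trop_piece W \<sigma>. trop_eval p u \<in> S} =
      (\<lambda>p. restrict (trop_eval p) (dual_cone W \<sigma>)) -` {g \<in> topspace ?T. g u \<in> (- {- \<infinity>}) \<inter> S}
        \<inter> trop_piece W \<sigma>"
    using assms(1) by (auto simp: trop_eval_def split: prod.splits)
  ultimately show ?thesis
    unfolding trop_piece_topology_def openin_pullback_topology by blast
qed

text \<open>For \<tau> in a fan, the trace on the open stratum is the part of \<open>W\<close> where
  \<open>u\<close> exceeds \<open>c\<close>, and every stratum of the piece on which
  \<open>u\<close> is infinite is contained entirely.\<close>

definition trop_halfspace ::
    "'a::euclidean_space set \<Rightarrow> 'a set \<Rightarrow> 'a \<Rightarrow> real \<Rightarrow> 'a trop_pt set" where
  "trop_halfspace W \<tau> u c = {p \<in> trop_piece W \<tau>. ereal c < trop_eval p u}"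

lemma trop_eval_point_eq:
  "trop_eval (trop_point \<tau> w) u = (if \<forall>x\<in>\<tau>. u \<bullet> x = 0 then ereal (u \<bullet> w) else \<infinity>)"
  using trop_eval_point[of \<tau> u w] trop_eval_point_infinity[of _ \<tau> u w] by auto

text \<open>It is enough to look at finitely many generators of \<sigma>. If \<open>u0\<close>
  vanishes at a generator, this lies in the common part and \<open>u\<close> is nonnegative there;
  otherwise a large multiple of \<open>u0\<close> outweighs \<open>u\<close>.\<close>

lemma dual_cone_shift:
  fixes W :: "'a::euclidean_space set"
  assumes \<sigma>: "polyhedron \<sigma>" "cone \<sigma>" "0 \<in> \<sigma>" "\<sigma> \<subseteq> W" "subspace W"
    and u: "u \<in> dual_cone W (\<sigma> \<inter> \<tau>)"
    and u0: "u0 \<in> dual_cone W \<sigma>" "\<And>x. x \<in> \<sigma> \<Longrightarrow> u0 \<bullet> x = 0 \<Longrightarrow> x \<in> \<tau>"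
  obtains N where "0 \<le> N" "u + N *\<^sub>R u0 \<in> dual_cone W \<sigma>"
proof -
  obtain V where V: "finite V" "\<sigma> = convex_cone hull V"
    using polyhedral_cone_finitely_generated[of \<sigma>] \<sigma> by blast
  have "\<exists>n\<ge>0. \<forall>N\<ge>n. 0 \<le> (u + N *\<^sub>R u0) \<bullet> g" if "g \<in> V" for g
  proof -
    have g: "g \<in> \<sigma>" using V that hull_inc by fastforce
    show ?thesis
    proof (cases "u0 \<bullet> g = 0")
      case True
      then have "0 \<le> u \<bullet> g" using u u0 g by (auto simp: dual_cone_def)
      with True show ?thesis by (intro exI[of _ 0]) (auto simp: inner_add_left)
    next
      case False
      then have pos: "0 < u0 \<bullet> g" using u0(1) g by (force simp: dual_cone_def)
      have "0 \<le> u \<bullet> g + N * (u0 \<bullet> g)" if "\<bar>u \<bullet> g\<bar> / (u0 \<bullet> g) \<le> N" for N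
      proof -
        have "\<bar>u \<bullet> g\<bar> \<le> N * (u0 \<bullet> g)" using that pos by (simp add: divide_simps)
        then show ?thesis by linarith
      qed
      then show ?thesis using pos
        by (intro exI[of _ "\<bar>u \<bullet> g\<bar> / (u0 \<bullet> g)"]) (auto simp: inner_add_left)
    qed
  qed
  then obtain n where n: "\<And>g. g \<in> V \<Longrightarrow> 0 \<le> n g \<and> (\<forall>N\<ge>n g. 0 \<le> (u + N *\<^sub>R u0) \<bullet> g)"
    by metis
  define N where "N = (\<Sum>g\<in>V. n g)"
  have N: "n g \<le> N" if "g \<in> V" for g
    unfolding N_def using V n that by (intro member_le_sum) auto
  have "V \<subseteq> {x. (u + N *\<^sub>R u0) \<bullet> x \<ge> 0}" using n N by auto
  then have "\<sigma> \<subseteq> {x. (u + N *\<^sub>R u0) \<bullet> x \<ge> 0}"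
    unfolding V(2) by (intro hull_minimal convex_cone_halfspace_ge)
  moreover have "u + N *\<^sub>R u0 \<in> W"
    using u u0 \<sigma> by (auto simp: dual_cone_def intro: subspace_add subspace_scale)
  moreover have "0 \<le> N" unfolding N_def using n by (intro sum_nonneg) blast
  ultimately show ?thesis using that[of N] by (auto simp: dual_cone_def)
qed

text \<open>Faces of polyhedra are exposed, and the hyperplane passes through the origin because 0
  is in the face. A change of sign and projection to \<open>W\<close> give an element of the dual
  cone.\<close>

lemma expose_common_face:
  fixes W :: "'a::euclidean_space set"
  assumes \<sigma>: "polyhedron \<sigma>" "cone \<sigma>" "0 \<in> \<sigma>" "\<sigma> \<subseteq> W" "subspace W"
    and face: "\<sigma> \<inter> \<tau> face_of \<sigma>" and "0 \<in> \<tau>"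
  obtains u where "u \<in> dual_cone W \<sigma>" "\<And>x. x \<in> \<sigma> \<Longrightarrow> u \<bullet> x = 0 \<longleftrightarrow> x \<in> \<tau>"
proof -
  have "\<sigma> \<inter> \<tau> exposed_face_of \<sigma>"
    using exposed_face_of_polyhedron \<sigma> face by blast
  then obtain a b where ab: "\<sigma> \<subseteq> {x. a \<bullet> x \<le> b}" "\<sigma> \<inter> \<tau> = \<sigma> \<inter> {x. a \<bullet> x = b}"
    unfolding exposed_face_of_def by blast
  have "0 \<in> \<sigma> \<inter> {x. a \<bullet> x = b}" using \<sigma> \<open>0 \<in> \<tau>\<close> ab(2) by blast
  then have b: "b = 0" by simp
  obtain u where u: "u \<in> W" "\<And>x. x \<in> W \<Longrightarrow> u \<bullet> x = (- a) \<bullet> x"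
    using representative_in_subspace[OF \<sigma>(5), of "- a"] by blast
  show ?thesis
  proof (rule that[of u])
    show "u \<in> dual_cone W \<sigma>" using u ab b \<sigma> by (auto simp: dual_cone_def subset_iff)
    fix x assume x: "x \<in> \<sigma>"
    then have "u \<bullet> x = - (a \<bullet> x)" using u \<sigma> by auto
    then show "u \<bullet> x = 0 \<longleftrightarrow> x \<in> \<tau>" using ab b x by auto
  qed
qed

lemma fan_memD:
  assumes "fan \<Sigma>" "\<sigma> \<in> \<Sigma>"
  shows "polyhedron \<sigma>" "cone \<sigma>" "0 \<in> \<sigma>" "pointed \<sigma>" "convex \<sigma>" "closed \<sigma>"
proof -
  show *: "polyhedron \<sigma>" "cone \<sigma>" "pointed \<sigma>"
    using assms unfolding fan_def polyhedral_complex_def by blast+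
  show "0 \<in> \<sigma>" using *(3) unfolding pointed_def by blast
  show "convex \<sigma>" "closed \<sigma>"
    using *(1) by (simp_all add: polyhedron_imp_convex polyhedron_imp_closed)
qed

lemma fan_face_mem: "fan \<Sigma> \<Longrightarrow> \<sigma> \<in> \<Sigma> \<Longrightarrow> \<tau> face_of \<sigma> \<Longrightarrow> \<tau> \<noteq> {} \<Longrightarrow> \<tau> \<in> \<Sigma>"
  unfolding fan_def polyhedral_complex_def by blast

lemma fan_Int_face: "fan \<Sigma> \<Longrightarrow> \<sigma> \<in> \<Sigma> \<Longrightarrow> \<tau> \<in> \<Sigma> \<Longrightarrow> \<sigma> \<inter> \<tau> face_of \<sigma> \<and> \<sigma> \<inter> \<tau> face_of \<tau>"
  unfolding fan_def polyhedral_complex_def by blast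

text \<open>Openness is tested in the piece of every \<sigma>, but \<open>u\<close> may be negative
  somewhere on \<sigma> and then is no coordinate of that piece. With \<open>u0\<close> exposing the
  common face, \<open>u0\<close> and \<open>u + N *\<^sub>R u0\<close> are coordinates for a
  suitable \<open>N\<close>.\<close>

lemma openin_trop_halfspace:
  fixes W :: "'a::euclidean_space set"
  assumes W: "subspace W" and \<Sigma>: "fan \<Sigma>" "\<And>\<sigma>. \<sigma> \<in> \<Sigma> \<Longrightarrow> \<sigma> \<subseteq> W"
    and \<tau>: "\<tau> \<in> \<Sigma>" and u: "u \<in> dual_cone W \<tau>"
  shows "openin (trop_toric W \<Sigma>) (trop_halfspace W \<tau> u c)"
  unfolding openin_trop_toric
proof (intro conjI ballI)
  have "face_complex \<tau> \<subseteq> \<Sigma>"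
    using fan_face_mem[OF \<Sigma>(1) \<tau>] by (auto simp: face_complex_def)
  then show "trop_halfspace W \<tau> u c \<subseteq> trop_carrier W \<Sigma>"
    unfolding trop_halfspace_def trop_carrier_def by blast
next
  fix \<sigma> assume \<sigma>: "\<sigma> \<in> \<Sigma>"
  note \<sigma>D = fan_memD[OF \<Sigma>(1) \<sigma>] and \<tau>D = fan_memD[OF \<Sigma>(1) \<tau>]
  have face: "\<sigma> \<inter> \<tau> face_of \<sigma>" "\<sigma> \<inter> \<tau> face_of \<tau>"
    using fan_Int_face[OF \<Sigma>(1) \<sigma> \<tau>] by auto
  obtain u0 where u0: "u0 \<in> dual_cone W \<sigma>" "\<And>x. x \<in> \<sigma> \<Longrightarrow> u0 \<bullet> x = 0 \<longleftrightarrow> x \<in> \<tau>"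
    using expose_common_face[OF \<sigma>D(1-3) \<Sigma>(2)[OF \<sigma>] W face(1) \<tau>D(3)] by blast
  have "u \<in> dual_cone W (\<sigma> \<inter> \<tau>)" using u by (auto simp: dual_cone_def)
  then obtain N where N: "0 \<le> N" "u + N *\<^sub>R u0 \<in> dual_cone W \<sigma>"
    using dual_cone_shift[OF \<sigma>D(1-3) \<Sigma>(2)[OF \<sigma>] W, of u \<tau> u0] u0 by blast
  let ?u1 = "u + N *\<^sub>R u0"
  \<comment> \<open>A finite bound on \<open>u0\<close> confines the point to strata of faces of the
    intersection of \<sigma> and \<tau>; there \<open>u0\<close> below \<open>r\<close> and
    \<open>?u1\<close> above \<open>c + N * r\<close> give \<open>u\<close> above
    \<open>c\<close>.\<close>
  define G where "G = (\<lambda>r::real. {p \<in> trop_piece W \<sigma>. trop_eval p u0 \<in> {..<ereal r}} \<inter>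
     {p \<in> trop_piece W \<sigma>. trop_eval p ?u1 \<in> {ereal (c + N * r)<..}})"
  have "trop_halfspace W \<tau> u c \<inter> trop_piece W \<sigma> = (\<Union>r. G r)"
  proof (intro set_eqI iffI)
    fix p assume p: "p \<in> trop_halfspace W \<tau> u c \<inter> trop_piece W \<sigma>"
    then obtain \<rho> w where pw: "p = trop_point \<rho> w" "w \<in> W" "\<rho> \<in> face_complex \<sigma>"
      by (auto simp: trop_carrier_def)
    have "\<rho> \<in> face_complex \<tau>"
      using p pw by (auto simp: trop_halfspace_def trop_carrier_def trop_point_def)
    then have "\<rho> \<subseteq> \<sigma> \<inter> \<tau>" using pw by (auto simp: face_complex_def dest: face_of_imp_subset)
    then have z: "\<forall>x\<in>\<rho>. u0 \<bullet> x = 0" using u0 by auto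
    then have e0: "trop_eval p u0 = ereal (u0 \<bullet> w)" by (simp add: pw trop_eval_point_eq)
    have c: "ereal c < trop_eval p u" using p by (simp add: trop_halfspace_def)
    show "p \<in> (\<Union>r. G r)"
    proof (cases "\<forall>x\<in>\<rho>. u \<bullet> x = 0")
      case True
      then have "c < u \<bullet> w" using c by (simp add: pw trop_eval_point_eq)
      \<comment> \<open>For \<open>r = u0 \<bullet> w + e\<close> the condition on
        \<open>?u1\<close> amounts to \<open>N * e < u \<bullet> w - c\<close>; the denominator uses
        \<open>N + 1\<close> because \<open>N\<close> may be 0.\<close>
      define e where "e = (u \<bullet> w - c) / (2 * (N + 1))"
      have e: "0 < e" "N * e < u \<bullet> w - c"
      proof -
        show e0: "0 < e" using \<open>c < u \<bullet> w\<close> N by (simp add: e_def)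
        have "u \<bullet> w - c = 2 * (N + 1) * e" using N by (simp add: e_def)
        also have "\<dots> = N * e + ((N + 2) * e)" by (simp add: algebra_simps)
        finally show "N * e < u \<bullet> w - c" using e0 N by (smt (verit) mult_pos_pos)
      qed
      have "p \<in> G (u0 \<bullet> w + e)"
        using p e e0 True z unfolding G_def
        by (auto simp: pw trop_eval_point_eq inner_add_left algebra_simps)
      then show ?thesis by blast
    next
      case False
      \<comment> \<open>As \<open>u0\<close> vanishes on \<rho>, the value of \<open>?u1\<close> at
        \<open>p\<close> is infinite together with that of \<open>u\<close>, and any
        \<open>r\<close> above the value of \<open>u0\<close> serves.\<close>
      then have "\<not> (\<forall>x\<in>\<rho>. ?u1 \<bullet> x = 0)" using z by (auto simp: inner_add_left)
      then have "trop_eval p ?u1 = \<infinity>" unfolding pw(1) trop_eval_point_eq by (simp only: if_False)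
      then have "p \<in> G (u0 \<bullet> w + 1)" using p e0 unfolding G_def by auto
      then show ?thesis by blast
    qed
  next
    fix p assume "p \<in> (\<Union>r. G r)"
    then obtain r where r: "p \<in> trop_piece W \<sigma>" "trop_eval p u0 < ereal r"
        "ereal (c + N * r) < trop_eval p ?u1"
      by (auto simp: G_def)
    then obtain \<rho> w where pw: "p = trop_point \<rho> w" "w \<in> W" "\<rho> face_of \<sigma>" "\<rho> \<noteq> {}"
      by (auto simp: trop_carrier_def face_complex_def)
    have z: "\<forall>x\<in>\<rho>. u0 \<bullet> x = 0" and w: "u0 \<bullet> w < r"
      using r(2) by (auto simp: pw trop_eval_point_eq split: if_splits)
    then have "\<rho> \<subseteq> \<sigma> \<inter> \<tau>" using u0 face_of_imp_subset[OF pw(3)] by blast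
    then have "\<rho> face_of \<tau>"
      using face_of_subset[OF pw(3)] face_of_trans face by (meson inf_le1)
    then have pt: "p \<in> trop_piece W \<tau>"
      using pw by (auto simp: trop_carrier_def face_complex_def)
    have "ereal c < trop_eval p u"
    proof (cases "\<forall>x\<in>\<rho>. u \<bullet> x = 0")
      case True
      then have "c + N * r < u \<bullet> w + N * (u0 \<bullet> w)"
        using r(3) z by (simp add: pw trop_eval_point_eq inner_add_left)
      moreover have "N * (u0 \<bullet> w) \<le> N * r" using N w by (intro mult_left_mono) auto
      ultimately show ?thesis using True by (simp add: pw trop_eval_point_eq)
    next
      case False
      then show ?thesis unfolding pw(1) trop_eval_point_eq by auto
    qed
    with pt r(1) show "p \<in> trop_halfspace W \<tau> u c \<inter> trop_piece W \<sigma>"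
      by (simp add: trop_halfspace_def)
  qed
  moreover have "openin (trop_piece_topology W \<sigma>) (G r)" for r
    unfolding G_def using u0(1) N(2) by (intro openin_Int openin_trop_piece_eval) auto
  ultimately show "openin (trop_piece_topology W \<sigma>) (trop_halfspace W \<tau> u c \<inter> trop_piece W \<sigma>)"
    by (metis (no_types, lifting) openin_Union imageE)
qed

lemma trop_embed_in_halfspaceD:
  assumes "trop_embed x \<in> trop_halfspace W \<tau> u c"
  shows "c < u \<bullet> x"
  using assms unfolding trop_halfspace_def trop_embed_def by (simp add: trop_eval_point_eq)

lemma trop_point_in_some_halfspace:
  assumes "\<tau> face_of \<tau>" "\<tau> \<noteq> {}" "w \<in> W"
  obtains c where "trop_point \<tau> w \<in> trop_halfspace W \<tau> u c"
proof (rule that[of "u \<bullet> w - 1"])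
  show "trop_point \<tau> w \<in> trop_halfspace W \<tau> u (u \<bullet> w - 1)"
    using assms by (auto simp: trop_halfspace_def trop_eval_point_eq trop_carrier_def face_complex_def)
qed

section \<open>The lower boundary of a polyhedron\<close>

text \<open>With the convention for \<open>v = 0\<close>, a polyhedron that is left uncut counts as
  a prism of height 0 over itself.\<close>

definition lower_part :: "'a::euclidean_space \<Rightarrow> 'a set \<Rightarrow> 'a set" where
  "lower_part v P = {x \<in> P. v = 0 \<or> (\<forall>t>0. x - t *\<^sub>R v \<notin> P)}"

lemma lower_part_zero [simp]: "lower_part 0 P = P"
  by (auto simp: lower_part_def)

lemma lower_part_subset: "lower_part v P \<subseteq> P"
  by (auto simp: lower_part_def)

lemma lower_partD: "x \<in> lower_part v P \<Longrightarrow> v \<noteq> 0 \<Longrightarrow> 0 < t \<Longrightarrow> x - t *\<^sub>R v \<notin> P"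
  by (auto simp: lower_part_def)

text \<open>Take a face of least dimension containing \<open>y\<close>: were \<open>y\<close> on its
  relative frontier, a smaller face would contain it. The shift by 1 makes dimensions from -1 on
  natural numbers.\<close>

lemma face_with_rel_interior_point:
  fixes P :: "'a::euclidean_space set"
  assumes "polyhedron P" "y \<in> P"
  obtains F where "F face_of P" "y \<in> rel_interior F"
proof -
  let ?Q = "\<lambda>F. F face_of P \<and> y \<in> F"
  have "?Q P" using assms by (simp add: face_of_refl polyhedron_imp_convex)
  then obtain F where F: "?Q F" and min: "\<And>G. ?Q G \<Longrightarrow> nat (aff_dim F + 1) \<le> nat (aff_dim G + 1)"
    using ex_has_least_nat[of ?Q P "\<lambda>F. nat (aff_dim F + 1)"] by blast
  have poly: "polyhedron F" using F assms face_of_polyhedron_polyhedron by blast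
  have "y \<in> rel_interior F"
  proof (rule ccontr)
    assume "y \<notin> rel_interior F"
    then have "y \<in> rel_frontier F"
      using F closure_subset by (auto simp: rel_frontier_def)
    then obtain G where G: "y \<in> G" "G face_of F" "G \<noteq> F"
      using rel_frontier_of_polyhedron_alt[OF poly] by auto
    then have "aff_dim G < aff_dim F"
      using poly by (intro face_of_aff_dim_lt polyhedron_imp_convex)
    moreover have "?Q G" using G F face_of_trans by blast
    moreover have "-1 \<le> aff_dim G" by (rule aff_dim_geq)
    ultimately show False using min[of G] by linarith
  qed
  with F that show ?thesis by blast
qed

text \<open>Take the face having \<open>y\<close> in its relative interior. If some \<open>z\<close>
  in it could be moved along \<open>- v\<close> within \<open>P\<close>, the segment from the moved
  point to a point of the face beyond \<open>y\<close> would pass through a point of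
  \<open>P\<close> below \<open>y\<close>.\<close>

lemma lower_part_face:
  fixes P :: "'a::euclidean_space set"
  assumes "polyhedron P" "y \<in> lower_part v P"
  obtains F where "F face_of P" "y \<in> F" "F \<subseteq> lower_part v P"
proof -
  have "y \<in> P" using assms lower_part_subset by blast
  then obtain F where F: "F face_of P" "y \<in> rel_interior F"
    using face_with_rel_interior_point assms by blast
  have FP: "F \<subseteq> P" using F face_of_imp_subset by blast
  have "z \<in> lower_part v P" if z: "z \<in> F" for z
  proof (rule ccontr)
    assume "z \<notin> lower_part v P"
    then obtain t where t: "v \<noteq> 0" "0 < t" "z - t *\<^sub>R v \<in> P"
      using z FP by (auto simp: lower_part_def)
    have "convex F" using F face_of_imp_convex by blast
    then obtain e where e: "1 < e" "(1 - e) *\<^sub>R z + e *\<^sub>R y \<in> F"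
      using F(2) z by (metis convex_rel_interior_iff emptyE)
    \<comment> \<open>The weight with which \<open>z\<close> and the point of \<open>F\<close>
      beyond \<open>y\<close> combine to \<open>y\<close> again.\<close>
    define u where "u = inverse e"
    have u: "0 < u" "u < 1" "u * e = 1" using e by (auto simp: u_def inverse_less_1_iff)
    have "u *\<^sub>R ((1 - e) *\<^sub>R z + e *\<^sub>R y) = (u * (1 - e)) *\<^sub>R z + (u * e) *\<^sub>R y"
      by (simp add: scaleR_right_distrib)
    also have "u * (1 - e) = - (1 - u)" using u by (simp add: algebra_simps)
    finally have "(1 - u) *\<^sub>R (z - t *\<^sub>R v) + u *\<^sub>R ((1 - e) *\<^sub>R z + e *\<^sub>R y) =
        y - ((1 - u) * t) *\<^sub>R v"
      using u(3) by (simp add: algebra_simps)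
    moreover have "(1 - u) *\<^sub>R (z - t *\<^sub>R v) + u *\<^sub>R ((1 - e) *\<^sub>R z + e *\<^sub>R y) \<in> P"
      by (rule convexD[OF polyhedron_imp_convex[OF assms(1)] t(3) subsetD[OF FP e(2)]])
        (use u in auto)
    moreover have "0 < (1 - u) * t" using u t by simp
    ultimately show False
      using lower_partD[OF assms(2) t(1)] by metis
  qed
  then show ?thesis
    using that[of F] F rel_interior_subset by blast
qed

text \<open>Descend from \<open>x\<close> along \<open>- v\<close> as far as \<open>P\<close>
  allows. Some depth \<open>s\<close> leaves \<open>P\<close>, as \<open>- v\<close> is no recession
  direction, and a deeper point cannot be in \<open>P\<close>, as \<open>v\<close> is one; so the
  set \<open>T\<close> of admissible depths is compact.\<close>

lemma lower_part_decomposition: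
  fixes P :: "'a::euclidean_space set"
  assumes P: "closed P" "convex P" and v: "v \<in> rec_cone P" "v \<noteq> 0 \<Longrightarrow> - v \<notin> rec_cone P"
    and x: "x \<in> P"
  obtains y t where "y \<in> lower_part v P" "0 \<le> t" "x = y + t *\<^sub>R v"
proof (cases "v = 0")
  case True
  then show ?thesis using that[of x 0] x by simp
next
  case False
  define T where "T = {t. 0 \<le> t \<and> x - t *\<^sub>R v \<in> P}"
  obtain s where s: "0 \<le> s" "x - s *\<^sub>R v \<notin> P"
    using rec_coneI_ray[OF P, of x "- v"] v(2) False by auto
  have "t \<le> s" if "t \<in> T" for t
  proof (rule ccontr)
    assume "\<not> t \<le> s"
    then have "(x - t *\<^sub>R v) + (t - s) *\<^sub>R v \<in> P"
      using that v(1) by (intro rec_coneD) (auto simp: T_def)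
    with s show False by (simp add: algebra_simps)
  qed
  then have "T = {0..s} \<inter> (\<lambda>t. x - t *\<^sub>R v) -` P"
    by (auto simp: T_def)
  moreover have "closed ((\<lambda>t. x - t *\<^sub>R v) -` P)"
    using P(1) by (intro closed_vimage continuous_intros)
  ultimately have "compact T" by (simp add: compact_Int_closed)
  moreover have "0 \<in> T" using x by (simp add: T_def)
  ultimately obtain t where t: "t \<in> T" "\<And>r. r \<in> T \<Longrightarrow> r \<le> t"
    using compact_attains_sup[of T] by blast
  have "x - t *\<^sub>R v \<in> lower_part v P"
    unfolding lower_part_def
  proof (intro CollectI conjI disjI2 allI impI)
    show "x - t *\<^sub>R v \<in> P" using t by (simp add: T_def)
    fix r :: real assume "0 < r"
    show "x - t *\<^sub>R v - r *\<^sub>R v \<notin> P"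
    proof
      assume "x - t *\<^sub>R v - r *\<^sub>R v \<in> P"
      then have "t + r \<in> T" using t \<open>0 < r\<close> by (simp add: T_def algebra_simps)
      with t(2)[of "t + r"] \<open>0 < r\<close> show False by simp
    qed
  qed
  then show ?thesis using that[of "x - t *\<^sub>R v" t] t by (simp add: T_def)
qed

lemma pointed_neg: "pointed \<sigma> \<Longrightarrow> v \<in> \<sigma> \<Longrightarrow> v \<noteq> 0 \<Longrightarrow> - v \<notin> \<sigma>"
  unfolding pointed_def by force

lemma zero_in_rec_cone: "0 \<in> rec_cone P"
  by (simp add: rec_cone_def)

lemma pointed_rec_cone_mono:
  "pointed (rec_cone P) \<Longrightarrow> rec_cone F \<subseteq> rec_cone P \<Longrightarrow> pointed (rec_cone F)"
  unfolding pointed_def using zero_in_rec_cone[of F] by (intro antisym) (blast, simp)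

text \<open>Induction on the dimension: \<open>P\<close> is covered by the sums of a ray in its recession cone and its lower
  faces, which are smaller.\<close>

lemma bounded_above_on_polyhedron:
  fixes P :: "'a::euclidean_space set"
  assumes "polyhedron P" "pointed (rec_cone P)" "\<And>x. x \<in> rec_cone P \<Longrightarrow> u \<bullet> x \<le> 0"
  shows "\<exists>M. \<forall>x\<in>P. u \<bullet> x \<le> M"
  using assms
proof (induction "nat (aff_dim P + 1)" arbitrary: P rule: less_induct)
  case less
  have P: "closed P" "convex P"
    using less.prems by (simp_all add: polyhedron_imp_closed polyhedron_imp_convex)
  show ?case
  proof (cases "bounded P")
    case True
    then obtain M where M: "\<And>x. x \<in> P \<Longrightarrow> norm x \<le> M"
      unfolding bounded_iff by blast
    have "u \<bullet> x \<le> norm u * M" if "x \<in> P" for x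
    proof -
      have "u \<bullet> x \<le> norm u * norm x" by (rule norm_cauchy_schwarz)
      also have "\<dots> \<le> norm u * M" using M[OF that] by (intro mult_left_mono) auto
      finally show ?thesis .
    qed
    then show ?thesis by blast
  next
    case False
    then obtain v where v: "v \<in> rec_cone P" "v \<noteq> 0"
      using unbounded_imp_rec_cone[OF P] by blast
    have neg: "- v \<notin> rec_cone P" using pointed_neg less.prems(2) v by blast
    let ?L = "{F. F face_of P \<and> F \<noteq> {} \<and> F \<subseteq> lower_part v P}"
    have fin: "finite ?L"
      by (rule finite_subset[OF _ finite_polyhedron_faces[OF less.prems(1)]]) auto
    have "\<exists>M. \<forall>x\<in>F. u \<bullet> x \<le> M" if F: "F \<in> ?L" for F
    proof (rule less.hyps)
      obtain y where y: "y \<in> F" "y \<in> P" using F face_of_imp_subset by blast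
      \<comment> \<open>A lower face is proper, hence of smaller dimension: moving up along
        \<open>v\<close> stays in \<open>P\<close> but leaves the lower part.\<close>
      have "y + 1 *\<^sub>R v \<notin> F"
      proof
        assume "y + 1 *\<^sub>R v \<in> F"
        then have "y + 1 *\<^sub>R v \<in> lower_part v P" using F by blast
        from lower_partD[OF this v(2), of 1] y show False by simp
      qed
      moreover have "y + 1 *\<^sub>R v \<in> P" using y v by (intro rec_coneD) auto
      ultimately have "F \<noteq> P" by blast
      then have "aff_dim F < aff_dim P" using F P by (intro face_of_aff_dim_lt) auto
      then show "nat (aff_dim F + 1) < nat (aff_dim P + 1)"
        using aff_dim_geq[of F] by linarith
      show "polyhedron F" using F less.prems face_of_polyhedron_polyhedron by blast
      have sub: "rec_cone F \<subseteq> rec_cone P"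
        using F P face_of_imp_subset by (intro rec_cone_subset_of_closed) auto
      show "pointed (rec_cone F)" by (rule pointed_rec_cone_mono[OF less.prems(2) sub])
      show "u \<bullet> x \<le> 0" if "x \<in> rec_cone F" for x
        using that sub less.prems(3) by blast
    qed
    then have "\<forall>F\<in>?L. \<exists>M. \<forall>x\<in>F. u \<bullet> x \<le> M" by blast
    then obtain M where "\<forall>F\<in>?L. \<forall>x\<in>F. u \<bullet> x \<le> M F" unfolding bchoice_iff by blast
    then have M: "u \<bullet> x \<le> M F" if "F \<in> ?L" "x \<in> F" for F x using that by blast
    \<comment> \<open>Absolute values make the sum of the finitely many bounds dominate each of
      them.\<close>
    have "u \<bullet> x \<le> (\<Sum>F\<in>?L. \<bar>M F\<bar>)" if x: "x \<in> P" for x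
    proof -
      obtain y t where yt: "y \<in> lower_part v P" "0 \<le> t" "x = y + t *\<^sub>R v"
        using lower_part_decomposition[OF P v(1) neg x] by blast
      obtain F where F: "F face_of P" "y \<in> F" "F \<subseteq> lower_part v P"
        using lower_part_face[OF less.prems(1) yt(1)] by blast
      then have FL: "F \<in> ?L" by blast
      have "u \<bullet> x = u \<bullet> y + t * (u \<bullet> v)" using yt by (simp add: inner_add_right)
      also have "\<dots> \<le> u \<bullet> y" using yt less.prems(3)[OF v(1)] by (simp add: mult_nonneg_nonpos)
      also have "\<dots> \<le> \<bar>M F\<bar>" using M[OF FL F(2)] by linarith
      also have "\<dots> \<le> (\<Sum>F\<in>?L. \<bar>M F\<bar>)" using fin FL by (intro member_le_sum) auto
      finally show ?thesis .
    qed
    then show ?thesis by blast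
  qed
qed

section \<open>Faces of Minkowski sums\<close>

text \<open>Addition maps \<open>A \<times> B\<close> linearly onto the sum, so the preimage
  \<open>T\<close> of \<open>H\<close> is a face of the product, and faces of products are products
  of faces.\<close>

lemma face_of_set_plus_decomp:
  fixes A B :: "'a::euclidean_space set"
  assumes "convex A" "convex B" "H face_of A + B" "H \<noteq> {}"
  obtains F G where "F face_of A" "G face_of B" "F \<noteq> {}" "G \<noteq> {}" "H = F + G"
proof -
  define T where "T = {p \<in> A \<times> B. fst p + snd p \<in> H}"
  have "T face_of A \<times> B"
    unfolding face_of_def
  proof (intro conjI ballI impI)
    show "T \<subseteq> A \<times> B" by (auto simp: T_def)
    have "linear (\<lambda>p::'a \<times> 'a. fst p + snd p)"
      by (auto intro!: linearI simp: scaleR_right_distrib)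
    then have "convex ((\<lambda>p. fst p + snd p) -` H)"
      using assms(3) by (intro convex_linear_vimage face_of_imp_convex)
    then have "convex ((A \<times> B) \<inter> (\<lambda>p. fst p + snd p) -` H)"
      using assms by (intro convex_Int convex_Times)
    moreover have "T = (A \<times> B) \<inter> (\<lambda>p. fst p + snd p) -` H" by (auto simp: T_def)
    ultimately show "convex T" by simp
  next
    fix p q r assume p: "p \<in> A \<times> B" and q: "q \<in> A \<times> B" and r: "r \<in> T" "r \<in> open_segment p q"
    have sums: "fst p + snd p \<in> A + B" "fst q + snd q \<in> A + B"
      using p q by auto
    obtain u where u: "0 < u" "u < 1" "r = (1 - u) *\<^sub>R p + u *\<^sub>R q"
      using r by (auto simp: in_segment)
    have eq: "fst r + snd r = (1 - u) *\<^sub>R (fst p + snd p) + u *\<^sub>R (fst q + snd q)"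
      unfolding u(3) fst_add snd_add fst_scaleR snd_scaleR by (simp add: algebra_simps)
    have "fst p + snd p \<in> H \<and> fst q + snd q \<in> H"
    \<comment> \<open>When both sums coincide the open segment between them is empty, but then the
      sum at \<open>r\<close> is the same point.\<close>
    proof (cases "fst p + snd p = fst q + snd q")
      case True
      then have "fst r + snd r = fst p + snd p" unfolding eq by (simp add: algebra_simps)
      with r True show ?thesis by (simp add: T_def)
    next
      case False
      then have "fst r + snd r \<in> open_segment (fst p + snd p) (fst q + snd q)"
        using u eq unfolding in_segment by blast
      then show ?thesis
        using face_ofD[OF assms(3) _ sums] r by (simp add: T_def)
    qed
    with p q show "p \<in> T" "q \<in> T" by (auto simp: T_def)
  qed
  then obtain F G where FG: "F face_of A" "G face_of B" "T = F \<times> G"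
    using face_of_Times_decomp by blast
  have "H = F + G"
  proof (intro set_eqI iffI)
    fix h assume h: "h \<in> H"
    then have "h \<in> A + B" using assms face_of_imp_subset by blast
    then obtain a b where ab: "a \<in> A" "b \<in> B" "h = a + b" by (auto elim: set_plus_elim)
    then have "(a, b) \<in> T" using h by (simp add: T_def)
    then show "h \<in> F + G" using FG ab by auto
  next
    fix h assume "h \<in> F + G"
    then obtain a b where ab: "a \<in> F" "b \<in> G" "h = a + b" by (auto elim: set_plus_elim)
    then have "(a, b) \<in> T" using FG by simp
    then show "h \<in> H" using ab by (simp add: T_def)
  qed
  moreover from this have "F \<noteq> {}" "G \<noteq> {}"
    using assms(4) by (auto simp: set_plus_def)
  ultimately show ?thesis using that FG by blast
qed

text \<open>A sum of faces need not be a face in general. If points of \<open>A + B\<close> split in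
  only one way, convex combinations split into convex combinations in \<open>A\<close> and in
  \<open>B\<close>, and the two face properties apply separately.\<close>

lemma face_of_set_plus:
  fixes A B :: "'a::euclidean_space set"
  assumes conv: "convex A" "convex B" and F: "F face_of A" and G: "G face_of B"
    and unique: "\<And>a b a' b'. a \<in> A \<Longrightarrow> b \<in> B \<Longrightarrow> a' \<in> A \<Longrightarrow> b' \<in> B \<Longrightarrow> a + b = a' + b' \<Longrightarrow>
      a = a' \<and> b = b'"
  shows "F + G face_of A + B"
  unfolding face_of_def
proof (intro conjI ballI impI)
  have sub: "F \<subseteq> A" "G \<subseteq> B" using F G face_of_imp_subset by auto
  show "F + G \<subseteq> A + B" using sub by (rule set_plus_mono2)
  show "convex (F + G)" using F G by (intro convex_set_plus face_of_imp_convex)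
  fix p q x assume p: "p \<in> A + B" and q: "q \<in> A + B" and x: "x \<in> F + G" "x \<in> open_segment p q"
  obtain a b where ab: "a \<in> A" "b \<in> B" "p = a + b" using p by (auto elim: set_plus_elim)
  obtain a' b' where ab': "a' \<in> A" "b' \<in> B" "q = a' + b'" using q by (auto elim: set_plus_elim)
  obtain f g where fg: "f \<in> F" "g \<in> G" "x = f + g" using x by (auto elim: set_plus_elim)
  obtain u where u: "0 < u" "u < 1" "x = (1 - u) *\<^sub>R p + u *\<^sub>R q"
    using x by (auto simp: in_segment)
  have "f + g = ((1 - u) *\<^sub>R a + u *\<^sub>R a') + ((1 - u) *\<^sub>R b + u *\<^sub>R b')"
    using u(3) fg(3) ab ab' by (simp add: algebra_simps)
  moreover have "(1 - u) *\<^sub>R a + u *\<^sub>R a' \<in> A" "(1 - u) *\<^sub>R b + u *\<^sub>R b' \<in> B"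
    using u conv ab ab' by (auto intro!: convexD)
  ultimately have eq: "f = (1 - u) *\<^sub>R a + u *\<^sub>R a'" "g = (1 - u) *\<^sub>R b + u *\<^sub>R b'"
    using unique fg sub by blast+
  have "a \<in> F \<and> a' \<in> F"
  proof (cases "a = a'")
    case True
    with eq fg show ?thesis by (simp add: algebra_simps)
  next
    case False
    then have "f \<in> open_segment a a'" using u eq unfolding in_segment by blast
    then show ?thesis using face_ofD[OF F] ab ab' fg by blast
  qed
  moreover have "b \<in> G \<and> b' \<in> G"
  proof (cases "b = b'")
    case True
    with eq fg show ?thesis by (simp add: algebra_simps)
  next
    case False
    then have "g \<in> open_segment b b'" using u eq unfolding in_segment by blast
    then show ?thesis using face_ofD[OF G] ab ab' fg by blast
  qed
  ultimately show "p \<in> F + G" "q \<in> F + G" using ab ab' by auto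
qed

section \<open>Cutting polyhedra into prisms along a ray\<close>

text \<open>Here \<open>K P\<close> stands for a subdivision of the ray spanned by
  \<open>v P\<close>. For \<open>v P = 0\<close> and \<open>K P = {{0}}\<close>, the polyhedron
  contributes just its nonempty faces.\<close>

definition prism_refinement ::
    "'a::euclidean_space set set \<Rightarrow> ('a set \<Rightarrow> 'a) \<Rightarrow> ('a set \<Rightarrow> 'a set set) \<Rightarrow> 'a set set" where
  "prism_refinement \<K> v K =
     {F + B |F B P. P \<in> \<K> \<and> F face_of P \<and> F \<noteq> {} \<and> F \<subseteq> lower_part (v P) P \<and> B \<in> K P}"

text \<open>The gluing condition is \<open>coherent\<close>: if the direction of \<open>P\<close> is
  also a recession direction of \<open>P \<inter> Q\<close>, then \<open>Q\<close> is cut along the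
  same ray by the same cells.\<close>

locale prism_data =
  fixes \<K> :: "'a::euclidean_space set set" and v :: "'a set \<Rightarrow> 'a" and K :: "'a set \<Rightarrow> 'a set set"
  assumes complex: "polyhedral_complex \<K>"
    and v_rec: "P \<in> \<K> \<Longrightarrow> v P \<in> rec_cone P"
    and not_line: "P \<in> \<K> \<Longrightarrow> v P \<noteq> 0 \<Longrightarrow> - v P \<notin> rec_cone P"
    and coherent: "P \<in> \<K> \<Longrightarrow> Q \<in> \<K> \<Longrightarrow> P \<inter> Q \<noteq> {} \<Longrightarrow> v P \<noteq> 0 \<Longrightarrow> v P \<in> rec_cone (P \<inter> Q) \<Longrightarrow>
      v Q = v P \<and> K Q = K P"
    and K_complex: "P \<in> \<K> \<Longrightarrow> polyhedral_complex (K P)"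
    and K_cover: "P \<in> \<K> \<Longrightarrow> \<Union>(K P) = {t *\<^sub>R v P |t. 0 \<le> t}"
    and K_zero: "P \<in> \<K> \<Longrightarrow> {0} \<in> K P"
    and K_bounded: "P \<in> \<K> \<Longrightarrow> B \<in> K P \<Longrightarrow> bounded B"
    and sum_polyhedron: "P \<in> \<K> \<Longrightarrow> F face_of P \<Longrightarrow> F \<noteq> {} \<Longrightarrow> B \<in> K P \<Longrightarrow> polyhedron (F + B)"
begin

lemma member:
  assumes "P \<in> \<K>"
  shows "polyhedron P" "P \<noteq> {}" "convex P" "closed P"
  using assms complex unfolding polyhedral_complex_def
  by (simp_all add: polyhedron_imp_closed polyhedron_imp_convex)

lemma member_face: "P \<in> \<K> \<Longrightarrow> F face_of P \<Longrightarrow> F \<noteq> {} \<Longrightarrow> F \<in> \<K>"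
  using complex unfolding polyhedral_complex_def by blast

lemma member_Int: "P \<in> \<K> \<Longrightarrow> Q \<in> \<K> \<Longrightarrow> P \<inter> Q face_of P"
  using complex unfolding polyhedral_complex_def by blast

lemma K_Int: "P \<in> \<K> \<Longrightarrow> B \<in> K P \<Longrightarrow> C \<in> K P \<Longrightarrow> B \<inter> C face_of B"
  using K_complex[of P] unfolding polyhedral_complex_def by blast

lemma K_face: "P \<in> \<K> \<Longrightarrow> B \<in> K P \<Longrightarrow> C face_of B \<Longrightarrow> C \<noteq> {} \<Longrightarrow> C \<in> K P"
  using K_complex[of P] unfolding polyhedral_complex_def by blast

lemma K_ray:
  assumes "P \<in> \<K>" "B \<in> K P" "b \<in> B"
  obtains t where "0 \<le> t" "b = t *\<^sub>R v P"
  using K_cover[OF assms(1)] assms by blast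

lemma K_member:
  assumes "P \<in> \<K>" "B \<in> K P"
  shows "polyhedron B" "B \<noteq> {}" "convex B" "compact B"
proof -
  show *: "polyhedron B" "B \<noteq> {}"
    using assms K_complex unfolding polyhedral_complex_def by blast+
  show "convex B" using * by (simp add: polyhedron_imp_convex)
  show "compact B"
    using * K_bounded assms by (simp add: compact_eq_bounded_closed polyhedron_imp_closed)
qed

text \<open>If the shift is nonzero, the face \<open>P \<inter> Q\<close> of \<open>P\<close>
  contains a point strictly above \<open>y\<close>, hence the whole ray from \<open>y\<close> by
  \<open>face_of_rec_direction\<close>. So \<open>v P\<close> is a recession direction of the
  intersection and \<open>coherent\<close> applies.\<close>

lemma foot_in_Int:
  assumes P: "P \<in> \<K>" and Q: "Q \<in> \<K>" and y: "y \<in> P" and t: "0 \<le> t" and x: "y + t *\<^sub>R v P \<in> Q"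
  shows "y \<in> Q" "t *\<^sub>R v P \<noteq> 0 \<Longrightarrow> v Q = v P \<and> K Q = K P"
proof -
  have "y \<in> Q \<and> (t *\<^sub>R v P \<noteq> 0 \<longrightarrow> v Q = v P \<and> K Q = K P)"
  proof (cases "t *\<^sub>R v P = 0")
    case True
    with x show ?thesis by simp
  next
    case False
    then have nz: "v P \<noteq> 0" "0 < t" using t by auto
    have "y + t *\<^sub>R v P \<in> P \<inter> Q"
      using x rec_coneD[OF v_rec[OF P] y t] by simp
    then have ray: "y + s *\<^sub>R v P \<in> P \<inter> Q" if "0 \<le> s" for s
      using face_of_rec_direction[OF member_Int[OF P Q] _ nz(2) y v_rec[OF P] nz(1) that] by blast
    have "y \<in> P \<inter> Q" using ray[of 0] by simp
    moreover have "v P \<in> rec_cone (P \<inter> Q)"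
      using member[OF P] member[OF Q] ray
      by (intro rec_coneI_ray[of _ y] closed_Int convex_Int) auto
    ultimately show ?thesis using coherent[OF P Q _ nz(1)] by blast
  qed
  then show "y \<in> Q" "t *\<^sub>R v P \<noteq> 0 \<Longrightarrow> v Q = v P \<and> K Q = K P" by auto
qed

text \<open>By \<open>foot_in_Int\<close> both feet lie in both members, and the directions agree
  unless \<open>b\<close> and \<open>c\<close> are both 0. Different heights would then put one foot
  below the other on one line, contradicting \<open>lower_part\<close>.\<close>

lemma decomposition_unique:
  assumes P: "P \<in> \<K>" and Q: "Q \<in> \<K>" and y: "y \<in> lower_part (v P) P" and z: "z \<in> lower_part (v Q) Q"
    and b: "b \<in> B" "B \<in> K P" and c: "c \<in> C" "C \<in> K Q" and eq: "y + b = z + c"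
  shows "y = z \<and> b = c \<and> (b \<noteq> 0 \<longrightarrow> v Q = v P \<and> K Q = K P)"
proof -
  obtain t where t: "0 \<le> t" "b = t *\<^sub>R v P" using K_ray[OF P b(2,1)] .
  obtain s where s: "0 \<le> s" "c = s *\<^sub>R v Q" using K_ray[OF Q c(2,1)] .
  have yP: "y \<in> P" and zQ: "z \<in> Q" using y z lower_part_subset by blast+
  have xP: "y + b \<in> P" using rec_coneD[OF v_rec[OF P] yP t(1)] t by simp
  have xQ: "z + c \<in> Q" using rec_coneD[OF v_rec[OF Q] zQ s(1)] s by simp
  have yQ: "y \<in> Q" "b \<noteq> 0 \<Longrightarrow> v Q = v P \<and> K Q = K P"
    using foot_in_Int[OF P Q yP t(1)] xQ eq t by auto
  have zP: "z \<in> P" "c \<noteq> 0 \<Longrightarrow> v P = v Q \<and> K P = K Q"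
    using foot_in_Int[OF Q P zQ s(1)] xP eq s by auto
  show ?thesis
  proof (cases "b = 0 \<and> c = 0")
    case True
    with eq show ?thesis by simp
  next
    case False
    then have vv: "v Q = v P" using yQ(2) zP(2) by auto
    have nz: "v P \<noteq> 0" using False s t vv by auto
    have e: "y + t *\<^sub>R v P = z + s *\<^sub>R v P" using eq s t vv by simp
    have "t = s"
    proof (rule ccontr)
      assume "t \<noteq> s"
      then consider "s < t" | "t < s" by linarith
      then show False
      proof cases
        case 1
        have "z - (t - s) *\<^sub>R v P = y" using e by (simp add: algebra_simps)
        moreover have "z - (t - s) *\<^sub>R v P \<notin> Q"
          using lower_partD[OF z, of "t - s"] 1 nz vv by simp
        ultimately show False using yQ by simp
      next
        case 2
        have "y - (s - t) *\<^sub>R v P = z" using e by (simp add: algebra_simps)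
        moreover have "y - (s - t) *\<^sub>R v P \<notin> P"
          using lower_partD[OF y nz, of "s - t"] 2 by simp
        ultimately show False using zP by simp
      qed
    qed
    then have "b = c" using s t vv by simp
    with eq yQ show ?thesis by simp
  qed
qed

lemma face_of_prism:
  assumes P: "P \<in> \<K>" and F: "F face_of P" "F \<subseteq> lower_part (v P) P" and B: "B \<in> K P"
    and G: "G face_of F" and C: "C face_of B"
  shows "G + C face_of F + B"
proof (rule face_of_set_plus[OF _ _ G C])
  show "convex F" "convex B" using F K_member[OF P B] by (auto simp: face_of_imp_convex)
  show "a = a' \<and> b = b'"
    if "a \<in> F" "b \<in> B" "a' \<in> F" "b' \<in> B" "a + b = a' + b'" for a b a' b'
    using decomposition_unique[OF P P _ _ that(2) B that(4) B that(5)] that F by blast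
qed

text \<open>By \<open>decomposition_unique\<close> the intersection can be formed in base and height
  separately. If the two subdivisions differ, common points have height 0; there the cell
  \<open>{0}\<close> of \<open>K P\<close> provides the face.\<close>

lemma prism_Int:
  assumes P: "P \<in> \<K>" "F face_of P" "F \<noteq> {}" "F \<subseteq> lower_part (v P) P" "B \<in> K P"
    and Q: "Q \<in> \<K>" "G face_of Q" "G \<noteq> {}" "G \<subseteq> lower_part (v Q) Q" "C \<in> K Q"
  shows "(F + B) \<inter> (G + C) face_of F + B"
proof -
  have uniq: "y = z \<and> b = c \<and> (b \<noteq> 0 \<longrightarrow> v Q = v P \<and> K Q = K P)"
    if "y \<in> F" "b \<in> B" "z \<in> G" "c \<in> C" "y + b = z + c" for y b z c
    using decomposition_unique[OF P(1) Q(1) _ _ that(2) P(5) that(4) Q(5) that(5)] that P(4) Q(4)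
    by blast
  have FG: "F \<inter> G face_of F"
    using member_Int member_face P Q by blast
  show ?thesis
  proof (cases "K Q = K P")
    case True
    have "(F + B) \<inter> (G + C) = (F \<inter> G) + (B \<inter> C)"
    proof (intro set_eqI iffI)
      fix x assume "x \<in> (F + B) \<inter> (G + C)"
      then obtain y b z c where "y \<in> F" "b \<in> B" "z \<in> G" "c \<in> C" "x = y + b" "y + b = z + c"
        by (auto elim!: set_plus_elim)
      then show "x \<in> (F \<inter> G) + (B \<inter> C)" using uniq[of y b z c] by blast
    qed (auto elim!: set_plus_elim)
    moreover have "B \<inter> C face_of B"
      using K_Int[OF P(1,5)] Q(5) True by simp
    ultimately show ?thesis using face_of_prism[OF P(1,2,4,5) FG] by simp
  next
    case False
    have "(F + B) \<inter> (G + C) = (F \<inter> G) + (B \<inter> C \<inter> {0})"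
    proof (intro set_eqI iffI)
      fix x assume "x \<in> (F + B) \<inter> (G + C)"
      then obtain y b z c where "y \<in> F" "b \<in> B" "z \<in> G" "c \<in> C" "x = y + b" "y + b = z + c"
        by (auto elim!: set_plus_elim)
      then show "x \<in> (F \<inter> G) + (B \<inter> C \<inter> {0})" using uniq[of y b z c] False by blast
    qed (auto elim!: set_plus_elim)
    moreover have "B \<inter> {0} face_of B"
      by (rule K_Int[OF P(1,5) K_zero[OF P(1)]])
    then have "B \<inter> C \<inter> {0} face_of B"
      by (cases "0 \<in> C") (auto simp: Int_assoc Int_absorb1)
    ultimately show ?thesis using face_of_prism[OF P(1,2,4,5) FG] by simp
  qed
qed

text \<open>A face of a prism is a sum of faces, and a face of a lower face is a lower face again;
  \<open>prism_Int\<close> settles intersections.\<close>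

lemma polyhedral_complex_prism_refinement: "polyhedral_complex (prism_refinement \<K> v K)"
  unfolding polyhedral_complex_def
proof (intro conjI ballI allI impI)
  fix R assume "R \<in> prism_refinement \<K> v K"
  then obtain F B P where R: "R = F + B" "P \<in> \<K>" "F face_of P" "F \<noteq> {}" "F \<subseteq> lower_part (v P) P" "B \<in> K P"
    by (auto simp: prism_refinement_def)
  show "polyhedron R" using R sum_polyhedron by blast
  show "R \<noteq> {}" using R K_member(2)[OF R(2,6)] by (auto simp: set_plus_def)
  show "H \<in> prism_refinement \<K> v K" if H: "H face_of R \<and> H \<noteq> {}" for H
  proof -
    have "convex F" using R face_of_imp_convex by blast
    then obtain F' B' where H': "F' face_of F" "B' face_of B" "F' \<noteq> {}" "B' \<noteq> {}" "H = F' + B'"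
      using face_of_set_plus_decomp[of F B H] H K_member[OF R(2,6)] R(1) by blast
    have "F' face_of P" "F' \<subseteq> lower_part (v P) P"
      using H' R face_of_trans face_of_imp_subset by blast+
    moreover have "B' \<in> K P"
      using H' R K_face by blast
    ultimately show ?thesis using H' R(2) unfolding prism_refinement_def by blast
  qed
  fix S assume "S \<in> prism_refinement \<K> v K"
  then obtain G C Q where S: "S = G + C" "Q \<in> \<K>" "G face_of Q" "G \<noteq> {}" "G \<subseteq> lower_part (v Q) Q" "C \<in> K Q"
    by (auto simp: prism_refinement_def)
  show "R \<inter> S face_of R" using prism_Int R S by simp
  show "R \<inter> S face_of S" using prism_Int[OF S(2-6) R(2-6)] R(1) S(1) by (simp add: Int_commute)
qed

lemma prism_subset:
  assumes "P \<in> \<K>" "F \<subseteq> P" "B \<in> K P"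
  shows "F + B \<subseteq> P"
proof
  fix x assume "x \<in> F + B"
  then obtain y b where yb: "y \<in> F" "b \<in> B" "x = y + b" by (auto elim: set_plus_elim)
  obtain t where "0 \<le> t" "b = t *\<^sub>R v P" using K_ray[OF assms(1,3) yb(2)] .
  then show "x \<in> P" using rec_coneD[OF v_rec[OF assms(1)], of y t] yb assms by auto
qed

lemma prism_refinement_cover:
  assumes P: "P \<in> \<K>" and x: "x \<in> P"
  shows "\<exists>R\<in>prism_refinement \<K> v K. x \<in> R \<and> R \<subseteq> P"
proof -
  obtain y t where yt: "y \<in> lower_part (v P) P" "0 \<le> t" "x = y + t *\<^sub>R v P"
    using lower_part_decomposition[OF member(4,3)[OF P] v_rec[OF P] not_line[OF P] x] by blast
  obtain F where F: "F face_of P" "y \<in> F" "F \<subseteq> lower_part (v P) P"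
    using lower_part_face[OF member(1)[OF P] yt(1)] .
  obtain B where B: "B \<in> K P" "t *\<^sub>R v P \<in> B"
    using K_cover[OF P] yt(2) by blast
  have "F + B \<in> prism_refinement \<K> v K"
    unfolding prism_refinement_def using P F B by blast
  moreover have "F + B \<subseteq> P" using prism_subset[OF P face_of_imp_subset[OF F(1)] B(1)] .
  ultimately show ?thesis using yt(3) F B by auto
qed

lemma prism_refinement_subset:
  assumes "R \<in> prism_refinement \<K> v K"
  shows "\<exists>P\<in>\<K>. R \<subseteq> P"
proof -
  obtain F B P where R: "R = F + B" "P \<in> \<K>" "F face_of P" "B \<in> K P"
    using assms by (auto simp: prism_refinement_def)
  have "R \<subseteq> P"
    unfolding R(1) by (rule prism_subset[OF R(2) face_of_imp_subset[OF R(3)] R(4)])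
  with R(2) show ?thesis by blast
qed

lemma subdivides_prism_refinement: "prism_refinement \<K> v K subdivides \<K>"
  unfolding subdivides_def
proof (intro conjI ballI)
  show "\<Union>(prism_refinement \<K> v K) = \<Union>\<K>"
    using prism_refinement_subset by (auto dest!: prism_refinement_cover) blast
  fix P assume P: "P \<in> \<K>"
  have "P = \<Union>{R \<in> prism_refinement \<K> v K. R \<subseteq> P}"
    using prism_refinement_cover[OF P] by blast
  then show "\<exists>S\<subseteq>prism_refinement \<K> v K. P = \<Union>S"
    by (intro exI[of _ "{R \<in> prism_refinement \<K> v K. R \<subseteq> P}"] conjI) auto
qed

lemma rec_cone_prism:
  assumes "P \<in> \<K>" "F face_of P" "F \<noteq> {}" "B \<in> K P"
  shows "rec_cone (F + B) = rec_cone F"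
  using member[OF member_face[OF assms(1-3)]] K_member[OF assms(1,4)]
  by (intro rec_cone_plus_compact)

text \<open>From a point of \<open>F\<close> moved up by \<open>v P\<close> one can descend within
  \<open>P\<close>, so it is not in the lower part. This is what makes the recession cone of a prism
  smaller than that of \<open>P\<close>.\<close>

lemma lower_face_direction:
  assumes "P \<in> \<K>" "F \<noteq> {}" "F \<subseteq> lower_part (v P) P" "v P \<noteq> 0"
  shows "v P \<notin> rec_cone F"
proof
  assume r: "v P \<in> rec_cone F"
  obtain y where y: "y \<in> F" using assms by blast
  then have "y + 1 *\<^sub>R v P \<in> lower_part (v P) P" using rec_coneD[OF r y, of 1] assms by auto
  from lower_partD[OF this assms(4), of 1] y assms lower_part_subset show False by force
qed

lemma unchanged_member:
  assumes "P \<in> \<K>" "v P = 0"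
  shows "P \<in> prism_refinement \<K> v K"
proof -
  have "P = P + {0}" by (auto simp: set_plus_def)
  then show ?thesis
    unfolding prism_refinement_def
    using assms member[OF assms(1)] K_zero[OF assms(1)] face_of_refl by fastforce
qed

text \<open>Near \<open>p\<close> there are only finitely many members of \<K>, each with finitely
  many faces, and by \<open>nbhd\<close> finitely many cells over each. The neighbourhoods belonging
  to these members are intersected.\<close>

lemma locally_finite_prism_refinement:
  assumes lf: "locally_finite_in X ((`) e ` \<K>)" and e: "inj e"
    and nbhd: "\<And>P p. P \<in> \<K> \<Longrightarrow> p \<in> topspace X \<Longrightarrow>
      \<exists>U. openin X U \<and> p \<in> U \<and> finite {B \<in> K P. \<exists>y\<in>P. \<exists>b\<in>B. e (y + b) \<in> U}"
  shows "locally_finite_in X ((`) e ` prism_refinement \<K> v K)"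
  unfolding locally_finite_in_def
proof (intro conjI ballI)
  have top: "e ` P \<subseteq> topspace X" if "P \<in> \<K>" for P
    using lf that unfolding locally_finite_in_def by blast
  show "\<Union>((`) e ` prism_refinement \<K> v K) \<subseteq> topspace X"
  proof (intro Union_least)
    fix S assume "S \<in> (`) e ` prism_refinement \<K> v K"
    then obtain R where R: "R \<in> prism_refinement \<K> v K" "S = e ` R" by blast
    obtain P where P: "P \<in> \<K>" "R \<subseteq> P" using prism_refinement_subset[OF R(1)] by blast
    show "S \<subseteq> topspace X"
      unfolding R(2) using image_mono[OF P(2)] top[OF P(1)] by (rule order_trans)
  qed
  fix p assume p: "p \<in> topspace X"
  obtain V where V: "openin X V" "p \<in> V" "finite {U \<in> (`) e ` \<K>. U \<inter> V \<noteq> {}}"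
    using lf p unfolding locally_finite_in_def by blast
  define \<F> where "\<F> = {P \<in> \<K>. e ` P \<inter> V \<noteq> {}}"
  have "(`) e ` \<F> \<subseteq> {U \<in> (`) e ` \<K>. U \<inter> V \<noteq> {}}" by (auto simp: \<F>_def)
  then have "finite ((`) e ` \<F>)" using V(3) by (rule finite_subset)
  moreover have "inj_on ((`) e) \<F>"
    using e by (simp add: inj_on_def inj_image_eq_iff)
  ultimately have fin: "finite \<F>" by (rule finite_imageD)
  have "\<forall>P\<in>\<F>. \<exists>U. openin X U \<and> p \<in> U \<and> finite {B \<in> K P. \<exists>y\<in>P. \<exists>b\<in>B. e (y + b) \<in> U}"
    using nbhd[OF _ p] by (simp add: \<F>_def)
  then obtain U where U: "\<And>P. P \<in> \<F> \<Longrightarrow> openin X (U P) \<and> p \<in> U P \<and>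
      finite {B \<in> K P. \<exists>y\<in>P. \<exists>b\<in>B. e (y + b) \<in> U P}"
    by (auto dest!: bchoice)
  define N where "N = \<Inter>(insert V (U ` \<F>))"
  have "openin X N" unfolding N_def using V U fin by (intro openin_Inter) auto
  moreover have "p \<in> N" unfolding N_def using V U by auto
  moreover have "finite {S \<in> (`) e ` prism_refinement \<K> v K. S \<inter> N \<noteq> {}}"
  proof (rule finite_subset)
    let ?D = "SIGMA P:\<F>. {F. F face_of P} \<times> {B \<in> K P. \<exists>y\<in>P. \<exists>b\<in>B. e (y + b) \<in> U P}"
    show "finite ((\<lambda>(P, F, B). e ` (F + B)) ` ?D)"
      using fin U member(1)
      by (intro finite_imageI finite_SigmaI finite_cartesian_product finite_polyhedron_faces)
        (auto simp: \<F>_def)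
    show "{S \<in> (`) e ` prism_refinement \<K> v K. S \<inter> N \<noteq> {}} \<subseteq> (\<lambda>(P, F, B). e ` (F + B)) ` ?D"
    proof
      fix S assume S: "S \<in> {S \<in> (`) e ` prism_refinement \<K> v K. S \<inter> N \<noteq> {}}"
      then obtain F B P where R: "S = e ` (F + B)" "P \<in> \<K>" "F face_of P" "B \<in> K P"
        by (auto simp: prism_refinement_def)
      have "e ` (F + B) \<inter> N \<noteq> {}" using S unfolding R(1) by simp
      then obtain x where x: "x \<in> F + B" "e x \<in> N" by (elim ex_in_conv[THEN iffD2, THEN exE]) (elim IntE imageE, simp)
      then obtain y b where yb: "y \<in> F" "b \<in> B" "x = y + b" by (auto elim: set_plus_elim)
      have FP: "F \<subseteq> P" using R(3) by (rule face_of_imp_subset)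
      have "x \<in> P" using prism_subset[OF R(2) FP R(4)] x(1) by (rule subsetD)
      moreover have "e x \<in> V" using x by (simp add: N_def)
      ultimately have PF: "P \<in> \<F>" using R(2) by (auto simp: \<F>_def)
      then have "e (y + b) \<in> U P" using x yb by (simp add: N_def)
      then have "(P, F, B) \<in> ?D" using PF R yb FP by auto
      then show "S \<in> (\<lambda>(P, F, B). e ` (F + B)) ` ?D" using R(1) by (auto intro!: image_eqI)
    qed
  qed
  ultimately show "\<exists>V. openin X V \<and> p \<in> V \<and> finite {S \<in> (`) e ` prism_refinement \<K> v K. S \<inter> V \<noteq> {}}"
    by blast
qed

end

section \<open>Subdivided rays\<close>

text \<open>If 0 lies strictly between \<open>a\<close> and \<open>b\<close>, positive multiples of
  them are opposite, hence 0 by pointedness.\<close>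

lemma zero_face_of_pointed_cone:
  assumes "cone \<sigma>" "pointed \<sigma>"
  shows "{0} face_of \<sigma>"
proof -
  have 0: "0 \<in> \<sigma>" using assms by (auto simp: pointed_def)
  have "a = 0 \<and> b = 0" if ab: "a \<in> \<sigma>" "b \<in> \<sigma>" "0 \<in> open_segment a b" for a b
  proof -
    obtain u where u: "a \<noteq> b" "0 < u" "u < 1" "0 = (1 - u) *\<^sub>R a + u *\<^sub>R b"
      using ab(3) by (auto simp: in_segment)
    have mem: "(1 - u) *\<^sub>R a \<in> \<sigma>" "u *\<^sub>R b \<in> \<sigma>"
      using assms(1) ab u by (auto intro: mem_cone)
    have "- ((1 - u) *\<^sub>R a) = u *\<^sub>R b" using u(4) by (simp add: minus_unique)
    with mem have "(1 - u) *\<^sub>R a = 0" using pointed_neg[OF assms(2)] by metis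
    with u show ?thesis by auto
  qed
  then show ?thesis
    using 0 unfolding face_of_def by auto
qed

lemma locally_finite_meets_compact:
  fixes \<rho> C :: "'a::euclidean_space set"
  assumes lf: "locally_finite_in (top_of_set \<rho>) \<K>" and C: "compact C" "C \<subseteq> \<rho>"
  shows "finite {B \<in> \<K>. B \<inter> C \<noteq> {}}"
proof -
  have "\<exists>N. open N \<and> x \<in> N \<and> finite {B \<in> \<K>. B \<inter> (\<rho> \<inter> N) \<noteq> {}}" if "x \<in> C" for x
  proof -
    have "x \<in> topspace (top_of_set \<rho>)" using that C by auto
    then obtain V where "openin (top_of_set \<rho>) V" "x \<in> V" "finite {B \<in> \<K>. B \<inter> V \<noteq> {}}"
      using lf unfolding locally_finite_in_def by blast
    then show ?thesis unfolding openin_open by blast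
  qed
  then obtain N where N: "\<And>x. x \<in> C \<Longrightarrow> open (N x) \<and> x \<in> N x \<and> finite {B \<in> \<K>. B \<inter> (\<rho> \<inter> N x) \<noteq> {}}"
    by metis
  obtain D where D: "D \<subseteq> C" "finite D" "C \<subseteq> (\<Union>x\<in>D. N x)"
    using compactE_image[OF C(1), of C N] N by blast
  have "{B \<in> \<K>. B \<inter> C \<noteq> {}} \<subseteq> (\<Union>x\<in>D. {B \<in> \<K>. B \<inter> (\<rho> \<inter> N x) \<noteq> {}})"
    using D(3) C(2) by fastforce
  moreover have "finite (\<Union>x\<in>D. {B \<in> \<K>. B \<inter> (\<rho> \<inter> N x) \<noteq> {}})"
    using D N by (intro finite_UN_I) auto
  ultimately show ?thesis by (rule finite_subset)
qed

text \<open>Otherwise the segment from a nonzero \<open>y\<close> through 0 could be prolonged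
  within the cone, which would then contain \<open>- y\<close>.\<close>

lemma rel_interior_pointed_cone_nonzero:
  fixes \<sigma> :: "'a::euclidean_space set"
  assumes "convex \<sigma>" "cone \<sigma>" "pointed \<sigma>" "\<sigma> \<noteq> {0}"
  shows "0 \<notin> rel_interior \<sigma>"
proof
  assume z: "0 \<in> rel_interior \<sigma>"
  have "0 \<in> \<sigma>" using assms(3) by (auto simp: pointed_def)
  then obtain y where y: "y \<in> \<sigma>" "y \<noteq> 0" using assms(4) by blast
  then obtain e where e: "1 < e" "(1 - e) *\<^sub>R y + e *\<^sub>R 0 \<in> \<sigma>"
    using z convex_rel_interior_iff[OF assms(1), of 0] by blast
  have "(1 / (e - 1)) *\<^sub>R ((1 - e) *\<^sub>R y) \<in> \<sigma>"
    using mem_cone[OF assms(2) e(2), of "1 / (e - 1)"] e(1) by simp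
  moreover have "1 / (e - 1) * (1 - e) = -1" using e(1) by (simp add: divide_simps)
  ultimately have "- y \<in> \<sigma>" by simp
  then show False using pointed_neg[OF assms(3) y] by blast
qed

text \<open>The last conjunct is local finiteness in terms of height: finitely many cells meet any
  initial stretch of the ray.\<close>

definition ray_subdivision ::
    "'a::euclidean_space set set \<Rightarrow> 'a set \<Rightarrow> 'a \<Rightarrow> 'a set set \<Rightarrow> bool" where
  "ray_subdivision \<P> \<sigma> v K \<longleftrightarrow> v \<in> rel_interior \<sigma> \<and> v \<noteq> 0 \<and> polyhedral_complex K \<and> K \<subseteq> \<P> \<and>
    \<Union>K = {t *\<^sub>R v |t. 0 \<le> t} \<and> {0} \<in> K \<and> (\<forall>B\<in>K. polytope B) \<and>
    (\<forall>T. finite {B \<in> K. \<exists>t. 0 \<le> t \<and> t \<le> T \<and> t *\<^sub>R v \<in> B})"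

lemma dagger_ray_subdivision:
  fixes \<P> :: "'a::euclidean_space set set"
  assumes dag: "dagger \<P>" and \<sigma>: "\<sigma> \<in> rec_cone ` \<P>" "\<sigma> \<noteq> {0}" "convex \<sigma>" "cone \<sigma>" "pointed \<sigma>"
  shows "\<exists>v K. ray_subdivision \<P> \<sigma> v K"
proof -
  obtain \<rho> where \<rho>: "\<rho> \<in> rec_cone ` \<P>" "ray \<rho>" "\<rho> \<inter> rel_interior \<sigma> \<noteq> {}"
    using dag[unfolded dagger_def, THEN conjunct2, THEN conjunct1, rule_format, OF \<sigma>(1,2)] by blast
  obtain K where K: "polytopal_subdivision \<P> \<rho> K" "locally_finite_in (top_of_set \<rho>) K"
    using dag[unfolded dagger_def, THEN conjunct2, THEN conjunct2, rule_format, OF \<rho>(1,2)] by blast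
  obtain w where w: "w \<noteq> 0" "\<rho> = {t *\<^sub>R w |t. 0 \<le> t}" using \<rho>(2) unfolding ray_def by blast
  obtain s where s: "0 \<le> s" "s *\<^sub>R w \<in> rel_interior \<sigma>" using \<rho>(3) w(2) by blast
  have s0: "s \<noteq> 0" using rel_interior_pointed_cone_nonzero[OF \<sigma>(3,4,5,2)] s(2) by auto
  \<comment> \<open>The point where the ray meets the relative interior of \<sigma> becomes the
    generator of the ray.\<close>
  define v where "v = s *\<^sub>R w"
  have v0: "v \<noteq> 0" using s0 w by (simp add: v_def)
  have \<rho>v: "\<rho> = {t *\<^sub>R v |t. 0 \<le> t}"
  proof (intro set_eqI iffI)
    fix x assume "x \<in> \<rho>"
    then obtain t where t: "0 \<le> t" "x = t *\<^sub>R w" using w by blast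
    have "x = (t / s) *\<^sub>R v" using t s0 by (simp add: v_def)
    with t s show "x \<in> {t *\<^sub>R v |t. 0 \<le> t}" by (auto intro!: exI[of _ "t / s"])
  next
    fix x assume "x \<in> {t *\<^sub>R v |t. 0 \<le> t}"
    then obtain t where "0 \<le> t" "x = (t * s) *\<^sub>R w" by (auto simp: v_def)
    then show "x \<in> \<rho>" unfolding w(2) using s(1) by (auto intro!: exI[of _ "t * s"])
  qed
  have cone: "cone \<rho>" unfolding cone_def \<rho>v
    by (auto intro!: exI[of _ "_ * _"] mult_nonneg_nonneg) 
  have "pointed \<rho>"
  proof -
    have "x = 0" if x: "x \<in> \<rho>" "- x \<in> \<rho>" for x
    proof -
      obtain t where t: "0 \<le> t" "x = t *\<^sub>R v" using x(1) \<rho>v by auto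
      obtain r where r: "0 \<le> r" "- x = r *\<^sub>R v" using x(2) \<rho>v by auto
      note tr = t(1) r(1) t(2) r(2)
      have "(t + r) *\<^sub>R v = x + - x" by (simp only: scaleR_left_distrib flip: tr(3,4))
      then have "t = 0" using t(1) r(1) v0 by simp
      with tr show ?thesis by simp
    qed
    moreover have "0 \<in> \<rho>" unfolding \<rho>v by (auto intro!: exI[of _ 0])
    ultimately show ?thesis unfolding pointed_def by force
  qed
  then have zero_face: "{0} face_of \<rho>" using zero_face_of_pointed_cone cone by blast
  have Kc: "polyhedral_complex K" "K \<subseteq> \<P>" "\<And>B. B \<in> K \<Longrightarrow> polytope B" and sub: "K subdivides face_complex \<rho>"
    using K(1) unfolding polytopal_subdivision_def complex_in_def by auto
  have "convex \<rho>" using \<rho>(1) convex_rec_cone by blast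
  then have "\<Union>(face_complex \<rho>) = \<rho>"
    using face_of_imp_subset face_of_refl unfolding face_complex_def by blast
  then have cover: "\<Union>K = \<rho>" using sub unfolding subdivides_def by simp
  \<comment> \<open>The apex is a face of the ray and thus a union of cells, so the cell of this
    union through 0 is \<open>{0}\<close>.\<close>
  have "{0} \<in> face_complex \<rho>" using zero_face by (simp add: face_complex_def)
  then obtain S where S: "S \<subseteq> K" "{0} = \<Union>S" using sub unfolding subdivides_def by blast
  then obtain B where B: "B \<in> S" "0 \<in> B" by blast
  then have "B = {0}" using S by blast
  then have K0: "{0} \<in> K" using S B by blast
  have fin: "finite {B \<in> K. \<exists>t. 0 \<le> t \<and> t \<le> T \<and> t *\<^sub>R v \<in> B}" for T
  proof -
    let ?C = "(\<lambda>t. t *\<^sub>R v) ` {0..T}"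
    have "compact ?C" by (intro compact_continuous_image continuous_intros) auto
    moreover have "?C \<subseteq> \<rho>" unfolding \<rho>v by auto
    ultimately have "finite {B \<in> K. B \<inter> ?C \<noteq> {}}"
      by (rule locally_finite_meets_compact[OF K(2)])
    moreover have "{B \<in> K. \<exists>t. 0 \<le> t \<and> t \<le> T \<and> t *\<^sub>R v \<in> B} \<subseteq> {B \<in> K. B \<inter> ?C \<noteq> {}}" by force
    ultimately show ?thesis by (rule finite_subset[rotated])
  qed
  show ?thesis
    unfolding ray_subdivision_def
    by (intro exI[of _ v] exI[of _ K] conjI allI ballI fin Kc v0 K0)
      (use s cover \<rho>v in \<open>simp_all add: v_def\<close>)
qed

section \<open>Bounded height near the boundary\<close>

lemma rec_cone_subset_subspace:
  assumes "subspace W" "P \<subseteq> W" "P \<noteq> {}"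
  shows "rec_cone P \<subseteq> W"
proof
  fix v assume v: "v \<in> rec_cone P"
  obtain x where x: "x \<in> P" using assms by blast
  then have "x + 1 *\<^sub>R v \<in> P" using v by (intro rec_coneD) auto
  then have "(x + v) - x \<in> W" using x assms by (intro subspace_diff) auto
  then show "v \<in> W" by simp
qed

lemma bounded_height_neighbourhood:
  fixes W :: "'a::euclidean_space set"
  assumes W: "subspace W" and \<Sigma>: "fan \<Sigma>" "\<And>\<sigma>. \<sigma> \<in> \<Sigma> \<Longrightarrow> \<sigma> \<subseteq> W"
    and P: "polyhedron P" "P \<noteq> {}" "P \<subseteq> W"
    and cone: "polyhedron (rec_cone P)" "pointed (rec_cone P)"
    and faces: "\<And>\<tau>. \<tau> \<in> \<Sigma> \<Longrightarrow> rec_cone P \<inter> \<tau> face_of rec_cone P"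
    and v: "v \<in> rec_cone P" "\<And>\<tau>. \<tau> \<in> \<Sigma> \<Longrightarrow> v \<notin> \<tau>"
    and p: "p \<in> trop_carrier W \<Sigma>"
  obtains U T where "openin (trop_toric W \<Sigma>) U" "p \<in> U"
    "\<And>y t. y \<in> P \<Longrightarrow> trop_embed (y + t *\<^sub>R v) \<in> U \<Longrightarrow> t \<le> T"
proof -
  obtain \<tau> w where \<tau>: "p = trop_point \<tau> w" "\<tau> \<in> \<Sigma>" "w \<in> W"
    using p by (auto simp: trop_carrier_def)
  note \<tau>D = fan_memD[OF \<Sigma>(1) \<tau>(2)]
  obtain u0 where u0: "\<And>x. x \<in> rec_cone P \<Longrightarrow> u0 \<bullet> x \<le> 0" "\<And>x. x \<in> \<tau> \<Longrightarrow> 0 \<le> u0 \<bullet> x" "u0 \<bullet> v < 0"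
    using separate_cones[OF cone(1) cone_rec_cone \<tau>D(1,2) faces[OF \<tau>(2)] v(1) v(2)[OF \<tau>(2)] \<tau>D(3)]
    by blast
  \<comment> \<open>Both \<open>rec_cone P\<close> and \<tau> lie in \<open>W\<close>, so passing to
    a form in \<open>W\<close> preserves the signs.\<close>
  obtain u where u: "u \<in> W" "\<And>x. x \<in> W \<Longrightarrow> u \<bullet> x = u0 \<bullet> x"
    using representative_in_subspace[OF W, of u0] by blast
  have rec: "rec_cone P \<subseteq> W" using rec_cone_subset_subspace[OF W P(3,2)] .
  have le: "u \<bullet> x \<le> 0" if "x \<in> rec_cone P" for x
    using u0(1)[OF that] u(2)[OF subsetD[OF rec that]] by simp
  have dual: "u \<in> dual_cone W \<tau>"
    using u u0(2) \<Sigma>(2)[OF \<tau>(2)] by (auto simp: dual_cone_def subset_iff)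
  have neg: "u \<bullet> v < 0" using u0(3) u(2) v(1) rec by auto
  obtain M where M: "\<And>x. x \<in> P \<Longrightarrow> u \<bullet> x \<le> M"
    using bounded_above_on_polyhedron[OF P(1) cone(2) le] by blast
  have "\<tau> face_of \<tau>" "\<tau> \<noteq> {}" using \<tau>D by (auto simp: face_of_refl)
  then obtain c where c: "p \<in> trop_halfspace W \<tau> u c"
    using trop_point_in_some_halfspace[of \<tau> w W u] \<tau> by blast
  show ?thesis
  \<comment> \<open>The bound on the height comes from solving
    \<open>c < M + t * (u \<bullet> v)\<close> for \<open>t\<close>, where
    \<open>u \<bullet> v\<close> is negative.\<close>
  proof (rule that[of "trop_halfspace W \<tau> u c" "(M - c) / - (u \<bullet> v)"])
    show "openin (trop_toric W \<Sigma>) (trop_halfspace W \<tau> u c)"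
      by (rule openin_trop_halfspace[OF W \<Sigma> \<tau>(2) dual])
    show "p \<in> trop_halfspace W \<tau> u c" by (rule c)
    fix y t assume y: "y \<in> P" and e: "trop_embed (y + t *\<^sub>R v) \<in> trop_halfspace W \<tau> u c"
    have "c < u \<bullet> y + t * (u \<bullet> v)"
      using trop_embed_in_halfspaceD[OF e] by (simp add: inner_add_right)
    then have "t * - (u \<bullet> v) \<le> M - c" using M[OF y] by simp
    then show "t \<le> (M - c) / - (u \<bullet> v)" using neg by (simp only: pos_le_divide_eq neg_0_less_iff_less)
  qed
qed

section \<open>Removing the recession cones outside the fan\<close>

text \<open>One round of cutting: members whose recession cone lies outside \<Sigma> and has the
  largest dimension allowed, \<open>n\<close>, are cut; all others are kept.\<close>

lemma remove_top_cones:
  fixes W :: "'a::euclidean_space set" and n :: nat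
  assumes W: "subspace W" and \<P>: "\<And>P. P \<in> \<P> \<Longrightarrow> polyhedron P \<and> P \<noteq> {} \<and> P \<subseteq> W"
    and dag: "dagger \<P>" and \<Sigma>: "fan \<Sigma>" "\<Sigma> \<subseteq> rec_cone ` \<P>"
    and \<Sigma>': "fan \<Sigma>'" "\<Sigma> \<subseteq> \<Sigma>'" "rec_cone ` \<K> \<subseteq> \<Sigma>'"
    and \<K>: "complex_in \<P> \<K>" "locally_finite_in_trop W \<Sigma> \<K>"
    and dim: "\<And>P. P \<in> \<K> \<Longrightarrow> rec_cone P \<notin> \<Sigma> \<Longrightarrow> aff_dim (rec_cone P) < int (Suc n)"
  obtains \<L> where "complex_in \<P> \<L>" "locally_finite_in_trop W \<Sigma> \<L>" "\<L> subdivides \<K>"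
    "rec_cone ` \<L> \<subseteq> rec_cone ` \<K>" "{P \<in> \<K>. rec_cone P \<in> \<Sigma>} \<subseteq> \<L>"
    "\<And>P. P \<in> \<L> \<Longrightarrow> rec_cone P \<notin> \<Sigma> \<Longrightarrow> aff_dim (rec_cone P) < int n"
proof -
  have K\<P>: "\<K> \<subseteq> \<P>" and Kc: "polyhedral_complex \<K>" using \<K>(1) by (auto simp: complex_in_def)
  have mem: "polyhedron P" "P \<noteq> {}" "P \<subseteq> W" "closed P" "convex P" if "P \<in> \<K>" for P
    using \<P> K\<P> that polyhedron_imp_closed polyhedron_imp_convex by blast+
  have Kface: "F \<in> \<K>" if "P \<in> \<K>" "F face_of P" "F \<noteq> {}" for P F
    using Kc that unfolding polyhedral_complex_def by blast
  have KInt: "P \<inter> Q face_of P \<and> P \<inter> Q face_of Q" if "P \<in> \<K>" "Q \<in> \<K>" for P Q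
    using Kc that unfolding polyhedral_complex_def by blast
  have \<Sigma>W: "\<sigma> \<subseteq> W" if \<sigma>: "\<sigma> \<in> \<Sigma>" for \<sigma>
  proof -
    obtain P where P: "P \<in> \<P>" "\<sigma> = rec_cone P" using \<Sigma>(2) \<sigma> by blast
    show ?thesis unfolding P(2) using \<P>[OF P(1)] by (intro rec_cone_subset_subspace[OF W]) auto
  qed
  have rec: "rec_cone P \<in> \<Sigma>'" if "P \<in> \<K>" for P using \<Sigma>'(3) that by blast
  note recD = fan_memD[OF \<Sigma>'(1) rec]
  obtain \<sigma>0 where \<sigma>0: "\<sigma>0 \<in> \<Sigma>" using \<Sigma>(1) by (auto simp: fan_def)
  have zero: "{0} \<in> \<Sigma>"
    using fan_face_mem[OF \<Sigma>(1) \<sigma>0 zero_face_of_pointed_cone[OF fan_memD(2,4)[OF \<Sigma>(1) \<sigma>0]]]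
    by simp
  \<comment> \<open>If \<tau> is outside \<Sigma>, so is \<sigma>, since \<Sigma> contains the faces
    of its members. The dimension bound then forbids \<tau> to be a proper face.\<close>
  have up: "\<tau> = \<sigma> \<and> \<sigma> \<notin> \<Sigma>"
    if P: "P \<in> \<K>" "\<sigma> = rec_cone P" and \<tau>: "\<tau> face_of \<sigma>" "\<tau> \<notin> \<Sigma>" "aff_dim \<tau> = int n" for P \<sigma> \<tau>
  proof -
    have ne: "\<tau> \<noteq> {}" using \<tau>(3) by auto
    have out: "\<sigma> \<notin> \<Sigma>" using fan_face_mem[OF \<Sigma>(1) _ \<tau>(1) ne] \<tau>(2) by blast
    then have "aff_dim \<sigma> \<le> int n" using dim[OF P(1)] P(2) by simp
    then have "\<tau> = \<sigma>" using face_of_aff_dim_lt[OF convex_rec_cone \<tau>(1)[unfolded P(2)]] P(2) \<tau>(3) by force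
    with out show ?thesis by blast
  qed
  define top where "top = (\<lambda>P. P \<in> \<K> \<and> rec_cone P \<notin> \<Sigma> \<and> aff_dim (rec_cone P) = int n)"
  have "\<exists>v K. ray_subdivision \<P> (rec_cone P) v K" if "top P" for P
  proof (rule dagger_ray_subdivision[OF dag])
    have P: "P \<in> \<K>" and out: "rec_cone P \<notin> \<Sigma>" using that by (simp_all add: top_def)
    show "rec_cone P \<noteq> {0}" using zero out by metis
    show "rec_cone P \<in> rec_cone ` \<P>" using P K\<P> by blast
    show "convex (rec_cone P)" "cone (rec_cone P)" "pointed (rec_cone P)"
      by (rule convex_rec_cone cone_rec_cone recD(4)[OF P])+
  qed
  \<comment> \<open>The choice is made for each recession cone and not for each polyhedron, so that
    polyhedra with equal cones are cut alike, as \<open>coherent\<close> demands.\<close>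
  then have "\<forall>\<sigma>\<in>rec_cone ` Collect top. \<exists>v K. ray_subdivision \<P> \<sigma> v K" by blast
  then obtain v0 K0 where "\<forall>\<sigma>\<in>rec_cone ` Collect top. ray_subdivision \<P> \<sigma> (v0 \<sigma>) (K0 \<sigma>)" by metis
  then have good: "ray_subdivision \<P> (rec_cone P) (v0 (rec_cone P)) (K0 (rec_cone P))" if "top P" for P
    using that by blast
  \<comment> \<open>The defaults \<open>0\<close> and \<open>{{0}}\<close> leave a polyhedron
    uncut.\<close>
  define v where "v = (\<lambda>P. if top P then v0 (rec_cone P) else 0)"
  define K where "K = (\<lambda>P. if top P then K0 (rec_cone P) else {{0}})"
  have v_rel: "v P \<in> rel_interior (rec_cone P)" "v P \<noteq> 0" if "top P" for P
    using good[OF that] that by (auto simp: ray_subdivision_def v_def)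
  have vK: "polyhedral_complex (K P)" "\<Union>(K P) = {t *\<^sub>R v P |t. 0 \<le> t}" "{0} \<in> K P"
    "\<And>B. B \<in> K P \<Longrightarrow> bounded B" for P
  proof -
    have "polyhedral_complex {{0::'a}}"
      unfolding polyhedral_complex_def using face_of_imp_subset[of _ "{0::'a}"]
      by (auto simp: face_of_refl polytope_imp_polyhedron polytope_sing)
    then show "polyhedral_complex (K P)" using good[of P] by (simp add: K_def ray_subdivision_def)
    show "\<Union>(K P) = {t *\<^sub>R v P |t. 0 \<le> t}"
      using good[of P] by (cases "top P") (auto simp: K_def v_def ray_subdivision_def)
    show "{0} \<in> K P" using good[of P] by (simp add: K_def ray_subdivision_def)
    show "bounded B" if "B \<in> K P" for B
      using good[of P] that polytope_imp_bounded by (cases "top P") (auto simp: K_def ray_subdivision_def)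
  qed
  have sum: "F + B \<in> \<P>" if "P \<in> \<K>" "F face_of P" "F \<noteq> {}" "B \<in> K P" for P F B
  proof (cases "top P")
    case True
    then have "B \<in> \<P>" using good[OF True] that(4) by (auto simp: K_def ray_subdivision_def)
    moreover have "F \<in> \<P>" using Kface[OF that(1-3)] K\<P> by blast
    ultimately show ?thesis using dag[unfolded dagger_def, THEN conjunct1] by blast
  next
    case False
    then have "F + B = F" using that(4) by (simp add: K_def set_plus_def)
    then show ?thesis using Kface[OF that(1-3)] K\<P> by auto
  qed
  have topD: "top P" if "v P \<noteq> 0" for P using that by (auto simp: v_def split: if_splits)
  interpret prism_data \<K> v K
  proof
    show "polyhedral_complex \<K>" by (rule Kc)
    fix P assume P: "P \<in> \<K>"
    show "v P \<in> rec_cone P"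
      using v_rel(1)[of P] rel_interior_subset zero_in_rec_cone by (cases "top P") (auto simp: v_def)
    then show "- v P \<notin> rec_cone P" if "v P \<noteq> 0"
      using pointed_neg[OF recD(4)[OF P]] that by blast
    show "polyhedral_complex (K P)" "\<Union>(K P) = {t *\<^sub>R v P |t. 0 \<le> t}" "{0} \<in> K P"
      by (rule vK)+
    show "bounded B" if "B \<in> K P" for B using that by (rule vK)
    show "polyhedron (F + B)" if "F face_of P" "F \<noteq> {}" "B \<in> K P" for F B
      using sum[OF P that] \<P> by blast
    fix Q assume Q: "Q \<in> \<K>" and ne: "P \<inter> Q \<noteq> {}" and nz: "v P \<noteq> 0" and r: "v P \<in> rec_cone (P \<inter> Q)"
    have t: "top P" by (rule topD[OF nz])
    \<comment> \<open>The face \<open>rec_cone (P \<inter> Q)\<close> contains \<open>v P\<close>, a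
      relative interior point of \<open>rec_cone P\<close>, hence is all of
      \<open>rec_cone P\<close>. So \<open>rec_cone P\<close> is a face of
      \<open>rec_cone Q\<close>, and \<open>up\<close> makes them equal.\<close>
    have fP: "rec_cone (P \<inter> Q) face_of rec_cone P" and fQ: "rec_cone (P \<inter> Q) face_of rec_cone Q"
      using KInt[OF P Q] ne mem(4,5)[OF P] mem(4,5)[OF Q] by (auto intro!: rec_cone_face_of)
    have "rec_cone P \<subseteq> rec_cone (P \<inter> Q)"
      using subset_of_face_of[OF fP order_refl] r v_rel(1)[OF t] by blast
    then have "rec_cone (P \<inter> Q) = rec_cone P" using face_of_imp_subset[OF fP] by blast
    then have "rec_cone P face_of rec_cone Q" using fQ by simp
    then have "rec_cone P = rec_cone Q" "rec_cone Q \<notin> \<Sigma>"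
      using up[OF Q refl, of "rec_cone P"] t by (auto simp: top_def)
    moreover from this have "top Q" using t Q by (simp add: top_def)
    ultimately show "v Q = v P \<and> K Q = K P" using t by (simp add: v_def K_def)
  qed
  let ?L = "prism_refinement \<K> v K"
  show ?thesis
  proof (rule that[of ?L])
    show "complex_in \<P> ?L"
      unfolding complex_in_def using polyhedral_complex_prism_refinement sum
      by (auto simp: prism_refinement_def)
    show "?L subdivides \<K>" by (rule subdivides_prism_refinement)
    show "rec_cone ` ?L \<subseteq> rec_cone ` \<K>"
    proof
      fix \<sigma> assume "\<sigma> \<in> rec_cone ` ?L"
      then obtain P F B where R: "\<sigma> = rec_cone (F + B)" "P \<in> \<K>" "F face_of P" "F \<noteq> {}" "B \<in> K P"
        by (auto simp: prism_refinement_def)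
      then show "\<sigma> \<in> rec_cone ` \<K>" using rec_cone_prism[OF R(2-5)] Kface[OF R(2-4)] by simp
    qed
    show "{P \<in> \<K>. rec_cone P \<in> \<Sigma>} \<subseteq> ?L"
    proof
      fix P assume "P \<in> {P \<in> \<K>. rec_cone P \<in> \<Sigma>}"
      then show "P \<in> ?L" by (intro unchanged_member) (auto simp: v_def top_def)
    qed
    show "aff_dim (rec_cone R) < int n" if R: "R \<in> ?L" "rec_cone R \<notin> \<Sigma>" for R
    proof -
      obtain P F B where F: "R = F + B" "P \<in> \<K>" "F face_of P" "F \<noteq> {}" "F \<subseteq> lower_part (v P) P" "B \<in> K P"
        using R(1) by (auto simp: prism_refinement_def)
      have rR: "rec_cone R = rec_cone F" unfolding F(1) by (rule rec_cone_prism[OF F(2-4,6)])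
      \<comment> \<open>In dimension \<open>n\<close>, \<open>up\<close> would give \<open>F\<close>
        the same recession cone as \<open>P\<close>, including \<open>v P\<close>, which is
        impossible for a lower face.\<close>
      have "aff_dim (rec_cone F) \<noteq> int n"
      proof
        assume d: "aff_dim (rec_cone F) = int n"
        have "rec_cone F face_of rec_cone P"
          using F mem[OF F(2)] by (intro rec_cone_face_of) auto
        then have eq: "rec_cone F = rec_cone P \<and> rec_cone P \<notin> \<Sigma>"
          using up[OF F(2) refl, of "rec_cone F"] d R(2) rR by simp
        then have t: "top P" using F(2) d by (simp add: top_def)
        have "v P \<in> rec_cone F" using v_rec[OF F(2)] eq by simp
        then show False using lower_face_direction[OF F(2,4,5) v_rel(2)[OF t]] by blast
      qed
      moreover have "aff_dim (rec_cone F) < int (Suc n)"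
        using dim[OF Kface[OF F(2-4)]] R(2) rR by simp
      ultimately show ?thesis using rR by simp
    qed
    show "locally_finite_in_trop W \<Sigma> ?L"
      unfolding locally_finite_in_trop_def
    proof (rule locally_finite_prism_refinement[OF _ inj_trop_embed])
      show "locally_finite_in (trop_toric W \<Sigma>) ((`) trop_embed ` \<K>)"
        using \<K>(2) by (simp add: locally_finite_in_trop_def)
      fix P p assume P: "P \<in> \<K>" and p: "p \<in> topspace (trop_toric W \<Sigma>)"
      show "\<exists>U. openin (trop_toric W \<Sigma>) U \<and> p \<in> U \<and>
          finite {B \<in> K P. \<exists>y\<in>P. \<exists>b\<in>B. trop_embed (y + b) \<in> U}"
      proof (cases "top P")
        case False
        then show ?thesis using p by (intro exI[of _ "topspace (trop_toric W \<Sigma>)"]) (auto simp: K_def)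
      next
        case True
        have faces: "rec_cone P \<inter> \<tau> face_of rec_cone P \<and> rec_cone P \<inter> \<tau> face_of \<tau>" if "\<tau> \<in> \<Sigma>" for \<tau>
          using fan_Int_face[OF \<Sigma>'(1) rec[OF P]] that \<Sigma>'(2) by blast
        \<comment> \<open>Otherwise the face \<open>rec_cone P \<inter> \<tau>\<close> contains a
          relative interior point of \<open>rec_cone P\<close> and is the whole of it; then
          \<open>rec_cone P\<close> is a face of \<tau> and belongs to \<Sigma>.\<close>
        have v_out: "v P \<notin> \<tau>" if \<tau>: "\<tau> \<in> \<Sigma>" for \<tau>
        proof
          assume "v P \<in> \<tau>"
          then have "rec_cone P \<inter> \<tau> \<inter> rel_interior (rec_cone P) \<noteq> {}"
            using v_rel(1)[OF True] v_rec[OF P] by blast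
          then have "rec_cone P \<subseteq> rec_cone P \<inter> \<tau>"
            using subset_of_face_of[of "rec_cone P \<inter> \<tau>" "rec_cone P" "rec_cone P"] faces[OF \<tau>] by blast
          then have "rec_cone P \<inter> \<tau> = rec_cone P" by blast
          then have "rec_cone P face_of \<tau>" using faces[OF \<tau>] by simp
          then have "rec_cone P \<in> \<Sigma>"
            using fan_face_mem[OF \<Sigma>(1) \<tau>] recD(3)[OF P] by blast
          with True show False by (simp add: top_def)
        qed
        have "p \<in> trop_carrier W \<Sigma>" using p topspace_trop_toric[OF \<Sigma>(1)] by simp
        then obtain U T where U: "openin (trop_toric W \<Sigma>) U" "p \<in> U"
          "\<And>y t. y \<in> P \<Longrightarrow> trop_embed (y + t *\<^sub>R v P) \<in> U \<Longrightarrow> t \<le> T"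
          using bounded_height_neighbourhood[OF W \<Sigma>(1) \<Sigma>W mem(1-3)[OF P] recD(1,4)[OF P] _ v_rec[OF P] v_out, of p]
            faces by blast
        have "{B \<in> K P. \<exists>y\<in>P. \<exists>b\<in>B. trop_embed (y + b) \<in> U}
            \<subseteq> {B \<in> K P. \<exists>t. 0 \<le> t \<and> t \<le> T \<and> t *\<^sub>R v P \<in> B}"
        proof clarsimp
          fix B y b assume B: "B \<in> K P" "y \<in> P" "b \<in> B" "trop_embed (y + b) \<in> U"
          obtain t where "0 \<le> t" "b = t *\<^sub>R v P" using K_ray[OF P B(1,3)] .
          then show "\<exists>t\<ge>0. t \<le> T \<and> t *\<^sub>R v P \<in> B" using U(3)[OF B(2)] B by blast
        qed
        moreover have "finite {B \<in> K P. \<exists>t. 0 \<le> t \<and> t \<le> T \<and> t *\<^sub>R v P \<in> B}"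
          using good[OF True] True by (simp add: ray_subdivision_def K_def v_def)
        ultimately have "finite {B \<in> K P. \<exists>y\<in>P. \<exists>b\<in>B. trop_embed (y + b) \<in> U}"
          by (rule finite_subset)
        with U(1,2) show ?thesis by blast
      qed
    qed
  qed
qed

lemma subdivides_trans:
  assumes "A subdivides B" "B subdivides C"
  shows "A subdivides C"
  unfolding subdivides_def
proof (intro conjI ballI)
  show "\<Union>A = \<Union>C" using assms by (simp add: subdivides_def)
  have AB: "\<forall>P\<in>B. \<exists>S\<subseteq>A. P = \<Union>S" and BC: "\<forall>P\<in>C. \<exists>S\<subseteq>B. P = \<Union>S"
    using assms by (simp_all add: subdivides_def)
  fix P assume P: "P \<in> C"
  obtain S where S: "S \<subseteq> B" "P = \<Union>S" using bspec[OF BC P] by metis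
  have "\<exists>T\<subseteq>A. Q = \<Union>T" if "Q \<in> S" for Q
    using bspec[OF AB subsetD[OF S(1) that]] .
  then obtain T where T: "\<And>Q. Q \<in> S \<Longrightarrow> T Q \<subseteq> A \<and> Q = \<Union>(T Q)" by metis
  show "\<exists>T\<subseteq>A. P = \<Union>T"
  proof (intro exI conjI)
    show "(\<Union>Q\<in>S. T Q) \<subseteq> A" using T by blast
    have "\<Union>S = (\<Union>Q\<in>S. \<Union>(T Q))" using T by simp
    then show "P = \<Union>(\<Union>Q\<in>S. T Q)" unfolding S(2) by blast
  qed
qed

lemma subdivides_refl: "K subdivides K"
  unfolding subdivides_def by (auto intro!: exI[of _ "{_}"])

text \<open>The rounds are iterated by induction on the dimension bound. Each round keeps the
  members whose recession cone is in \<Sigma> and produces no new recession cones, so the hypotheses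
  persist.\<close>

lemma remove_cones_outside:
  fixes W :: "'a::euclidean_space set" and n :: nat
  assumes W: "subspace W" and \<P>: "\<And>P. P \<in> \<P> \<Longrightarrow> polyhedron P \<and> P \<noteq> {} \<and> P \<subseteq> W"
    and dag: "dagger \<P>" and \<Sigma>: "fan \<Sigma>" "\<Sigma> \<subseteq> rec_cone ` \<P>" and \<Sigma>': "fan \<Sigma>'" "\<Sigma> \<subseteq> \<Sigma>'"
    and "rec_cone ` \<K> \<subseteq> \<Sigma>'" "complex_in \<P> \<K>" "locally_finite_in_trop W \<Sigma> \<K>"
    and "\<And>P. P \<in> \<K> \<Longrightarrow> rec_cone P \<notin> \<Sigma> \<Longrightarrow> aff_dim (rec_cone P) < int n"
  shows "\<exists>\<L>. complex_in \<P> \<L> \<and> locally_finite_in_trop W \<Sigma> \<L> \<and> \<L> subdivides \<K> \<and>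
    rec_cone ` \<L> \<subseteq> rec_cone ` \<K> \<and> {P \<in> \<K>. rec_cone P \<in> \<Sigma>} \<subseteq> \<L> \<and> rec_cone ` \<L> \<subseteq> \<Sigma>"
  using assms(8-)
proof (induction n arbitrary: \<K>)
  case 0
  \<comment> \<open>A recession cone contains 0, so its dimension is not negative and the bound
    leaves none outside \<Sigma>.\<close>
  have "rec_cone P \<in> \<Sigma>" if "P \<in> \<K>" for P
  proof (rule ccontr)
    assume "rec_cone P \<notin> \<Sigma>"
    then have "aff_dim (rec_cone P) < 0" using 0(4)[OF that] by simp
    then show False using zero_in_rec_cone[of P] by (simp add: aff_dim_negative_iff)
  qed
  then show ?case using 0 subdivides_refl by (intro exI[of _ \<K>]) auto
next
  case (Suc n)
  obtain \<L> where L: "complex_in \<P> \<L>" "locally_finite_in_trop W \<Sigma> \<L>" "\<L> subdivides \<K>"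
    "rec_cone ` \<L> \<subseteq> rec_cone ` \<K>" "{P \<in> \<K>. rec_cone P \<in> \<Sigma>} \<subseteq> \<L>"
    "\<And>P. P \<in> \<L> \<Longrightarrow> rec_cone P \<notin> \<Sigma> \<Longrightarrow> aff_dim (rec_cone P) < int n"
    using remove_top_cones[OF W \<P> dag \<Sigma> \<Sigma>' Suc.prems] by blast
  obtain \<M> where M: "complex_in \<P> \<M>" "locally_finite_in_trop W \<Sigma> \<M>" "\<M> subdivides \<L>"
    "rec_cone ` \<M> \<subseteq> rec_cone ` \<L>" "{P \<in> \<L>. rec_cone P \<in> \<Sigma>} \<subseteq> \<M>" "rec_cone ` \<M> \<subseteq> \<Sigma>"
    using Suc.IH[OF order_trans[OF L(4) Suc.prems(1)] L(1,2,6)] by blast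
  have "\<M> subdivides \<K>" using subdivides_trans[OF M(3) L(3)] .
  moreover have "{P \<in> \<K>. rec_cone P \<in> \<Sigma>} \<subseteq> \<M>" using L(5) M(5) by blast
  moreover have "rec_cone ` \<M> \<subseteq> rec_cone ` \<K>" using M(4) L(4) by (rule order_trans)
  ultimately show ?case using M(1,2,6) by (intro exI[of _ \<M>]) simp
qed

theorem theorem4p2:
  fixes W :: "'a::euclidean_space set"
    and \<P> \<C> \<Sigma> \<Phi> \<Pi>\<^sub>0 :: "'a set set"
  assumes "subspace W"
    and "\<forall>P\<in>\<P>. polyhedron P \<and> P \<noteq> {} \<and> P \<subseteq> W"
    and "dagger \<P>"
    and "\<C> = rec_cone ` \<P>"
    and "finite \<Sigma>" and "fan_in \<C> \<Sigma>"
    and "complex_in \<P> \<Phi>" and "complex_in \<P> \<Pi>\<^sub>0" and "\<Phi> \<subseteq> \<Pi>\<^sub>0"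
    and "locally_finite_in_trop W \<Sigma> \<Phi>" and "locally_finite_in_trop W \<Sigma> \<Pi>\<^sub>0"
    and "\<forall>P\<in>\<Phi>. rec_cone P \<in> \<Sigma>"
    and "fan (\<Sigma> \<union> rec_cone ` \<Pi>\<^sub>0)"
  shows "\<exists>\<Pi>\<^sub>1. complex_in \<P> \<Pi>\<^sub>1 \<and> \<Pi>\<^sub>1 subdivides \<Pi>\<^sub>0 \<and> locally_finite_in_trop W \<Sigma> \<Pi>\<^sub>1 \<and>
           \<Phi> \<subseteq> \<Pi>\<^sub>1 \<and> rec_cone ` \<Pi>\<^sub>1 = \<Sigma> \<inter> rec_cone ` \<Pi>\<^sub>0"
proof -
  have fan: "fan \<Sigma>" "\<Sigma> \<subseteq> rec_cone ` \<P>" using assms(4,6) by (auto simp: fan_in_def)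
  \<comment> \<open>The bound is strict, so the induction starts one above the dimension of the
    ambient space.\<close>
  have dim: "aff_dim (rec_cone P) < int (DIM('a) + 1)" for P :: "'a set"
    using aff_dim_le_DIM[of "rec_cone P"] by simp
  have \<P>: "polyhedron P \<and> P \<noteq> {} \<and> P \<subseteq> W" if "P \<in> \<P>" for P using assms(2) that by blast
  obtain \<Pi>\<^sub>1 where "complex_in \<P> \<Pi>\<^sub>1" "locally_finite_in_trop W \<Sigma> \<Pi>\<^sub>1" "\<Pi>\<^sub>1 subdivides \<Pi>\<^sub>0"
    "rec_cone ` \<Pi>\<^sub>1 \<subseteq> rec_cone ` \<Pi>\<^sub>0" "{P \<in> \<Pi>\<^sub>0. rec_cone P \<in> \<Sigma>} \<subseteq> \<Pi>\<^sub>1" "rec_cone ` \<Pi>\<^sub>1 \<subseteq> \<Sigma>"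
    using remove_cones_outside[OF assms(1) \<P> assms(3) fan assms(13) Un_upper1 Un_upper2 assms(8,11) dim]
    by blast
  \<comment> \<open>A cone of \<Sigma> that occurs in \<open>\<Pi>\<^sub>0\<close> is the recession
    cone of a polyhedron kept unchanged, which gives the missing inclusion.\<close>
  moreover from this have "\<Sigma> \<inter> rec_cone ` \<Pi>\<^sub>0 \<subseteq> rec_cone ` \<Pi>\<^sub>1" by blast
  moreover have "\<Phi> \<subseteq> {P \<in> \<Pi>\<^sub>0. rec_cone P \<in> \<Sigma>}" using assms(9,12) by blast
  ultimately show ?thesis by (intro exI[of _ \<Pi>\<^sub>1]) auto
qed

end
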